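(* Let $\mathcal{R}$ be a set of first-order rewrite rules with Leibniz representation $\Gamma_{\mathcal{R}}$. Suppose $\Gamma_{\mathcal{R}} \vdash e : t$ in $\mathbf{F}_2^\mu$ for a first-order term $t$, and $e \in \mathrm{HHN}$. Then for every position $m$ the evidence trace $[e]$ yields a rewrite sequence $t \to^* [e]_o(t) \to^* [e]_{s\cdot o}([e]_o(t)) \to^* \cdots \to^* [e]_m(\cdots[e]_o(t)\cdots)$ (all the actions involved being defined), i.e. $e$ acts faithfully on $t$.
   Context: First-order terms $t ::= x \mid F^n\,t_1\cdots t_n$; term contexts $C ::= \bullet \mid x \mid F^n\,C_1\cdots C_n$ (possibly several holes), $C[t_1,\dots,t_n]$ fills holes left to right. Rewrite rules $l\to r$ ($l$ not a variable, $\mathrm{FV}(r)\subseteq\mathrm{FV}(l)$); $C[\sigma l]\to C[\sigma r]$ for one-hole $C$; $\to^*$ its reflexive-transitive closure. Leibniz representation: $\Gamma_{\mathcal{R}}$ contains $\kappa:\forall p.\forall\underline{x}.\,p\,r\Rightarrow p\,l$ for each rule ($\kappa$ fresh, $\underline{x}$ the free variables of $l$, $p$ of kind $*\Rightarrow*$); function symbols $F^n$ get kind $*^n\Rightarrow*$; terms are read as types. System $\mathbf{F}_2^\mu$: evidence $e ::= \alpha \mid \kappa \mid \lambda\alpha.e \mid e\,e' \mid \mu\alpha.e \mid e\,T \mid \lambda x.e$; types $T ::= F \mid x \mid \lambda x.T \mid \forall x{:}K.T \mid T\,T' \mid T \Rightarrow T'$ with term kinds $K::=*\mid*\Rightarrow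 K$, all types well-kinded (in particular $\lambda x.T$ needs $x\in\mathrm{FV}(T)$); typing rules: declared variables/constants; (App) $e_2:T'\Rightarrow T$, $e_1:T'$ give $e_2e_1:T$; (Lam) $\Gamma,\alpha:T'\vdash e:T$ gives $\lambda\alpha.e:T'\Rightarrow T$; (Mu) $\Gamma,\alpha:T\vdash e:T$ gives $\mu\alpha.e:T$; (Inst) $e:\forall x{:}K.T$ gives $e\,T':[T'/x]T$; (Abs) $e:T$, $x\notin\mathrm{FV}(\Gamma)$ gives $\lambda x.e:\forall x{:}K.T$; (Conv) up to $\leftrightarrow_o^*$, $\to_o$ being the compatible closure of $(\lambda x.T)T'\to_o[T'/x]T$. Head reduction $\leadsto_{h\tau o}$: with $\mathcal{H} ::= \bullet \mid \mathcal{H}\,e \mid \lambda\alpha.\mathcal{H} \mid \lambda x.\mathcal{H}$, $\mathcal{C} ::= \bullet \mid \mathcal{C}\,e \mid \mathcal{C}\,T \mid \lambda\alpha.\mathcal{C} \mid \lambda x.\mathcal{C} \mid e\,\mathcal{C} \mid \mu\alpha.\mathcal{C}$: $\mathcal{H}[\mu\alpha.e]\leadsto\mathcal{H}[[\mu\alpha.e/\alpha]e]$, $\mathcal{H}[(\lambda\alpha.e)e']\leadsto\mathcal{H}[[e'/\alpha]e]$, $\mathcal{C}[(\lambda x.e)T]\leadsto\mathcal{C}[[T/x]e]$, $\mathcal{C}[T]\leadsto\mathcal{C}[T']$ if $T\to_oT'$. Erasure $|\cdot|$: $|\alpha|=\alpha$, $|\kappa|=\kappa$, $|\lambda\alpha.e|=\lambda\alpha.|e|$,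 $|\mu\alpha.e|=\mu\alpha.|e|$, $|e\,e'|=|e|\,|e'|$, $|\lambda x.e|=|e|$, $|e\,T|=|e|$. On erased terms, $\leadsto_{\beta\mu}$ is the compatible closure of $(\lambda\alpha.e)e'\leadsto[e'/\alpha]e$ and $\mu\alpha.e\leadsto[\mu\alpha.e/\alpha]e$. $\mathrm{HN}_0$ is the set of all erased terms; $e\in\mathrm{HN}_{n+1}$ iff $e\leadsto_{\beta\mu}^*\lambda\underline{\alpha}.\,h\,e_1\cdots e_k$ with $h$ a variable or constant and every $e_i\in\mathrm{HN}_n$; $e\in\mathrm{HHN}$ iff $|e|\in\mathrm{HN}_n$ for all $n\ge0$. Positions: $o$ and $s\cdot m$ for a position $m$. Evidence trace: if $e\leadsto_{h\tau o}^*\kappa\,T_1\cdots T_n\,e'$ with the $T_i$ in $\to_o$-normal form, then $[e]_o=\kappa\,T_1\cdots T_n$ and $[e]_{s\cdot m}=[e']_m$; otherwise undefined. Action: if $[e]_m=\kappa\,(\lambda x.C[x,\ldots,x])\,t_1\cdots t_n$ with $\kappa:\forall p.\forall x_1\ldots x_n.\,p\,r\Rightarrow p\,l$ and $\sigma=[t_1/x_1,\ldots,t_n/x_n]$, then $[e]_m(t)=C[\sigma r,\ldots,\sigma r]$ if $t=C[\sigma l,\ldots,\sigma l]$ (so that $t\to^*[e]_m(t)$ by rewriting each hole occurrence with $l\to r$), and $[e]_m(t)$ is undefined otherwise.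
   Formalization: Head contexts also include H T (else (μα.e) T is stuck); the action also accepts a partially applied symbol F t1..tn as κ's first argument, read as λx.F t1..tn x; types with ⇒ or ∀ have no term kind, so quantified variables are never instantiated by them. *)

theory Defs
  imports Main
begin

section \<open>First-order terms, contexts and rewriting\<close>

datatype 'f trm = Var nat | Fun 'f "'f trm list"

datatype 'f ctxt = Hole | CVar nat | CFun 'f "'f ctxt list"

text \<open>The arity of each symbol is given by a function \<open>ar\<close>; arities are not built into the datatypes.
  Rewriting a term that respects the arities with rules that do yields such terms again.\<close>

fun wf_trm :: "('f \<Rightarrow> nat) \<Rightarrow> 'f trm \<Rightarrow> bool" where
  "wf_trm ar (Var x) = True"
| "wf_trm ar (Fun f ts) = (length ts = ar f \<and> (\<forall>t\<in>set ts. wf_trm ar t))"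

fun occs :: "'f trm \<Rightarrow> nat list" where
  "occs (Var x) = [x]"
| "occs (Fun f ts) = concat (map occs ts)"

definition fv_list :: "'f trm \<Rightarrow> nat list" where
  "fv_list t = remdups (occs t)"

fun subst :: "(nat \<Rightarrow> 'f trm) \<Rightarrow> 'f trm \<Rightarrow> 'f trm" where
  "subst \<sigma> (Var x) = \<sigma> x"
| "subst \<sigma> (Fun f ts) = Fun f (map (subst \<sigma>) ts)"

fun holes :: "'f ctxt \<Rightarrow> nat" where
  "holes Hole = 1"
| "holes (CVar x) = 0"
| "holes (CFun f Cs) = sum_list (map holes Cs)"

text \<open>\<open>fill C ts\<close> is meant for \<open>length ts = holes C\<close> only.\<close>

fun fill :: "'f ctxt \<Rightarrow> 'f trm list \<Rightarrow> 'f trm"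
  and fills :: "'f ctxt list \<Rightarrow> 'f trm list \<Rightarrow> 'f trm list" where
  "fill Hole ts = hd ts"
| "fill (CVar x) ts = Var x"
| "fill (CFun f Cs) ts = Fun f (fills Cs ts)"
| "fills [] ts = []"
| "fills (C # Cs) ts = fill C (take (holes C) ts) # fills Cs (drop (holes C) ts)"

type_synonym 'f rule = "'f trm \<times> 'f trm"

definition wf_rule :: "('f \<Rightarrow> nat) \<Rightarrow> 'f rule \<Rightarrow> bool" where
  "wf_rule ar \<rho> \<longleftrightarrow> (case \<rho> of (l, r) \<Rightarrow>
     wf_trm ar l \<and> wf_trm ar r \<and> (\<nexists>x. l = Var x) \<and> set (fv_list r) \<subseteq> set (fv_list l))"

inductive rewrite :: "'f rule set \<Rightarrow> 'f trm \<Rightarrow> 'f trm \<Rightarrow> bool" for Rs where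
  "(l, r) \<in> Rs \<Longrightarrow> holes C = 1 \<Longrightarrow> rewrite Rs (fill C [subst \<sigma> l]) (fill C [subst \<sigma> r])"


section \<open>Kinds and types\<close>

text \<open>\<open>Arr K\<close> is the kind \<open>* \<Rightarrow> K\<close>. Types use de Bruijn indices for type variables.\<close>

datatype kind = Star | Arr kind

datatype 'f ty =
    TFun 'f
  | TVar nat
  | TLam "'f ty"
  | TAll kind "'f ty"
  | TApp "'f ty" "'f ty"
  | TImp "'f ty" "'f ty"

primrec tlift :: "nat \<Rightarrow> 'f ty \<Rightarrow> 'f ty" where
  "tlift c (TFun f) = TFun f"
| "tlift c (TVar i) = TVar (if i < c then i else Suc i)"
| "tlift c (TLam T) = TLam (tlift (Suc c) T)"
| "tlift c (TAll K T) = TAll K (tlift (Suc c) T)"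
| "tlift c (TApp T T') = TApp (tlift c T) (tlift c T')"
| "tlift c (TImp T T') = TImp (tlift c T) (tlift c T')"

primrec tsubst :: "nat \<Rightarrow> 'f ty \<Rightarrow> 'f ty \<Rightarrow> 'f ty" where
  "tsubst c S (TFun f) = TFun f"
| "tsubst c S (TVar i) = (if i < c then TVar i else if i = c then S else TVar (i - 1))"
| "tsubst c S (TLam T) = TLam (tsubst (Suc c) (tlift 0 S) T)"
| "tsubst c S (TAll K T) = TAll K (tsubst (Suc c) (tlift 0 S) T)"
| "tsubst c S (TApp T T') = TApp (tsubst c S T) (tsubst c S T')"
| "tsubst c S (TImp T T') = TImp (tsubst c S T) (tsubst c S T')"

primrec tfree :: "nat \<Rightarrow> 'f ty \<Rightarrow> bool" where
  "tfree c (TFun f) = False"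
| "tfree c (TVar i) = (i = c)"
| "tfree c (TLam T) = tfree (Suc c) T"
| "tfree c (TAll K T) = tfree (Suc c) T"
| "tfree c (TApp T T') = (tfree c T \<or> tfree c T')"
| "tfree c (TImp T T') = (tfree c T \<or> tfree c T')"

inductive ostep :: "'f ty \<Rightarrow> 'f ty \<Rightarrow> bool" where
  "ostep (TApp (TLam T) T') (tsubst 0 T' T)"
| "ostep T T' \<Longrightarrow> ostep (TLam T) (TLam T')"
| "ostep T T' \<Longrightarrow> ostep (TAll K T) (TAll K T')"
| "ostep T T' \<Longrightarrow> ostep (TApp T S) (TApp T' S)"
| "ostep S S' \<Longrightarrow> ostep (TApp T S) (TApp T S')"
| "ostep T T' \<Longrightarrow> ostep (TImp T S) (TImp T' S)"
| "ostep S S' \<Longrightarrow> ostep (TImp T S) (TImp T S')"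

definition onormal :: "'f ty \<Rightarrow> bool" where
  "onormal T \<longleftrightarrow> (\<nexists>T'. ostep T T')"

text \<open>Kind contexts assign a kind to every index; \<open>case_nat K \<Delta>\<close> extends \<open>\<Delta>\<close> by a new index 0.\<close>

inductive kinded :: "('f \<Rightarrow> nat) \<Rightarrow> (nat \<Rightarrow> kind) \<Rightarrow> 'f ty \<Rightarrow> kind \<Rightarrow> bool" for ar where
  "kinded ar \<Delta> (TFun f) ((Arr ^^ ar f) Star)"
| "kinded ar \<Delta> (TVar x) (\<Delta> x)"
| "kinded ar (case_nat Star \<Delta>) T K \<Longrightarrow> tfree 0 T \<Longrightarrow> kinded ar \<Delta> (TLam T) (Arr K)"
| "kinded ar \<Delta> T (Arr K) \<Longrightarrow> kinded ar \<Delta> T' Star \<Longrightarrow> kinded ar \<Delta> (TApp T T') K"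

text \<open>The kinds above are term kinds: a type having one contains neither \<open>\<Rightarrow>\<close> nor \<open>\<forall>\<close>. Implications and
  quantifications are built on top of the types of kind \<open>*\<close> and do not have a term kind, so that
  quantified variables are never instantiated by them.\<close>

inductive formula :: "('f \<Rightarrow> nat) \<Rightarrow> (nat \<Rightarrow> kind) \<Rightarrow> 'f ty \<Rightarrow> bool" for ar where
  "kinded ar \<Delta> T Star \<Longrightarrow> formula ar \<Delta> T"
| "formula ar \<Delta> T \<Longrightarrow> formula ar \<Delta> T' \<Longrightarrow> formula ar \<Delta> (TImp T T')"
| "formula ar (case_nat K \<Delta>) T \<Longrightarrow> formula ar \<Delta> (TAll K T)"

fun ty_of :: "'f trm \<Rightarrow> 'f ty" where
  "ty_of (Var x) = TVar x"
| "ty_of (Fun f ts) = foldl TApp (TFun f) (map ty_of ts)"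

text \<open>The type \<open>\<forall>p. \<forall>x\<^sub>1 \<dots> x\<^sub>n. p r \<Rightarrow> p l\<close>. Under its binders, \<open>p\<close> has index \<open>n\<close> and
  \<open>x\<^sub>n, \<dots>, x\<^sub>1\<close> have the indices \<open>0, \<dots>, n - 1\<close>.\<close>

definition leibniz :: "'f rule \<Rightarrow> 'f ty" where
  "leibniz \<rho> = (case \<rho> of (l, r) \<Rightarrow>
     let xs = fv_list l; n = length xs;
         idx = (\<lambda>x. n - 1 - length (takeWhile (\<lambda>y. y \<noteq> x) xs));
         p = (\<lambda>t. TApp (TVar n) (ty_of (subst (Var \<circ> idx) t)))
     in TAll (Arr Star) ((TAll Star ^^ n) (TImp (p r) (p l))))"

text \<open>A set of rewrite rules comes with a constant \<open>\<kappa>\<close> for each of its rules: it is a map \<open>R\<close> from the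
  constants, the underlying set of rules being \<open>ran R\<close>.\<close>

definition leibniz_env :: "('k \<rightharpoonup> 'f rule) \<Rightarrow> ('k \<rightharpoonup> 'f ty)" where
  "leibniz_env R = (\<lambda>k. map_option leibniz (R k))"


section \<open>Evidence\<close>

text \<open>Evidence variables and type variables have separate de Bruijn indices: \<open>ELam\<close> and \<open>EMu\<close> bind the
  evidence variable 0, \<open>ETLam\<close> binds the type variable 0.\<close>

datatype ('k, 'f) evid =
    EVar nat
  | ECon 'k
  | ELam "('k, 'f) evid"
  | EApp "('k, 'f) evid" "('k, 'f) evid"
  | EMu "('k, 'f) evid"
  | ETApp "('k, 'f) evid" "'f ty"
  | ETLam "('k, 'f) evid"

primrec elift :: "nat \<Rightarrow> ('k, 'f) evid \<Rightarrow> ('k, 'f) evid" where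
  "elift c (EVar i) = EVar (if i < c then i else Suc i)"
| "elift c (ECon k) = ECon k"
| "elift c (ELam e) = ELam (elift (Suc c) e)"
| "elift c (EApp e e') = EApp (elift c e) (elift c e')"
| "elift c (EMu e) = EMu (elift (Suc c) e)"
| "elift c (ETApp e T) = ETApp (elift c e) T"
| "elift c (ETLam e) = ETLam (elift c e)"

primrec etlift :: "nat \<Rightarrow> ('k, 'f) evid \<Rightarrow> ('k, 'f) evid" where
  "etlift c (EVar i) = EVar i"
| "etlift c (ECon k) = ECon k"
| "etlift c (ELam e) = ELam (etlift c e)"
| "etlift c (EApp e e') = EApp (etlift c e) (etlift c e')"
| "etlift c (EMu e) = EMu (etlift c e)"
| "etlift c (ETApp e T) = ETApp (etlift c e) (tlift c T)"
| "etlift c (ETLam e) = ETLam (etlift (Suc c) e)"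

primrec esubst :: "nat \<Rightarrow> ('k, 'f) evid \<Rightarrow> ('k, 'f) evid \<Rightarrow> ('k, 'f) evid" where
  "esubst c s (EVar i) = (if i < c then EVar i else if i = c then s else EVar (i - 1))"
| "esubst c s (ECon k) = ECon k"
| "esubst c s (ELam e) = ELam (esubst (Suc c) (elift 0 s) e)"
| "esubst c s (EApp e e') = EApp (esubst c s e) (esubst c s e')"
| "esubst c s (EMu e) = EMu (esubst (Suc c) (elift 0 s) e)"
| "esubst c s (ETApp e T) = ETApp (esubst c s e) T"
| "esubst c s (ETLam e) = ETLam (esubst c (etlift 0 s) e)"

primrec etsubst :: "nat \<Rightarrow> 'f ty \<Rightarrow> ('k, 'f) evid \<Rightarrow> ('k, 'f) evid" where
  "etsubst c S (EVar i) = EVar i"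
| "etsubst c S (ECon k) = ECon k"
| "etsubst c S (ELam e) = ELam (etsubst c S e)"
| "etsubst c S (EApp e e') = EApp (etsubst c S e) (etsubst c S e')"
| "etsubst c S (EMu e) = EMu (etsubst c S e)"
| "etsubst c S (ETApp e T) = ETApp (etsubst c S e) (tsubst c S T)"
| "etsubst c S (ETLam e) = ETLam (etsubst (Suc c) (tlift 0 S) e)"

text \<open>The typing environment is split into the types \<open>\<Sigma>\<close> of the constants, the kinds \<open>\<Delta>\<close> of the type
  variables and the types \<open>\<Gamma>\<close> of the evidence variables. The types in \<open>\<Sigma>\<close> are understood to be closed
  (as those of \<^const>\<open>leibniz_env\<close> are) and hence are not lifted in the rule \<open>Abs\<close>.\<close>

inductive typing :: "('f \<Rightarrow> nat) \<Rightarrow> ('k \<rightharpoonup> 'f ty) \<Rightarrow> (nat \<Rightarrow> kind) \<Rightarrow> 'f ty list \<Rightarrow>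
    ('k, 'f) evid \<Rightarrow> 'f ty \<Rightarrow> bool" for ar \<Sigma> where
  Var: "i < length \<Gamma> \<Longrightarrow> typing ar \<Sigma> \<Delta> \<Gamma> (EVar i) (\<Gamma> ! i)"
| Con: "\<Sigma> k = Some T \<Longrightarrow> typing ar \<Sigma> \<Delta> \<Gamma> (ECon k) T"
| App: "typing ar \<Sigma> \<Delta> \<Gamma> e2 (TImp T' T) \<Longrightarrow> typing ar \<Sigma> \<Delta> \<Gamma> e1 T' \<Longrightarrow> typing ar \<Sigma> \<Delta> \<Gamma> (EApp e2 e1) T"
| Lam: "formula ar \<Delta> T' \<Longrightarrow> typing ar \<Sigma> \<Delta> (T' # \<Gamma>) e T \<Longrightarrow> typing ar \<Sigma> \<Delta> \<Gamma> (ELam e) (TImp T' T)"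
| Mu: "formula ar \<Delta> T \<Longrightarrow> typing ar \<Sigma> \<Delta> (T # \<Gamma>) e T \<Longrightarrow> typing ar \<Sigma> \<Delta> \<Gamma> (EMu e) T"
| Inst: "typing ar \<Sigma> \<Delta> \<Gamma> e (TAll K T) \<Longrightarrow> kinded ar \<Delta> T' K \<Longrightarrow>
    typing ar \<Sigma> \<Delta> \<Gamma> (ETApp e T') (tsubst 0 T' T)"
| Abs: "typing ar \<Sigma> (case_nat K \<Delta>) (map (tlift 0) \<Gamma>) e T \<Longrightarrow> typing ar \<Sigma> \<Delta> \<Gamma> (ETLam e) (TAll K T)"
| Conv: "typing ar \<Sigma> \<Delta> \<Gamma> e T \<Longrightarrow> equivclp ostep T T' \<Longrightarrow> formula ar \<Delta> T' \<Longrightarrow> typing ar \<Sigma> \<Delta> \<Gamma> e T'"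

text \<open>The contexts \<open>\<H>\<close> include \<open>\<H> T\<close>: without it, \<open>(\<mu>\<alpha>. e) T\<close> would be irreducible, although its
  erasure is not.\<close>

inductive head_step :: "('k, 'f) evid \<Rightarrow> ('k, 'f) evid \<Rightarrow> bool" where
  "head_step (EMu e) (esubst 0 (EMu e) e)"
| "head_step (EApp (ELam e) e') (esubst 0 e' e)"
| "head_step e e' \<Longrightarrow> head_step (EApp e a) (EApp e' a)"
| "head_step e e' \<Longrightarrow> head_step (ETApp e T) (ETApp e' T)"
| "head_step e e' \<Longrightarrow> head_step (ELam e) (ELam e')"
| "head_step e e' \<Longrightarrow> head_step (ETLam e) (ETLam e')"

inductive tauo_step :: "('k, 'f) evid \<Rightarrow> ('k, 'f) evid \<Rightarrow> bool" where
  "tauo_step (ETApp (ETLam e) T) (etsubst 0 T e)"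
| "ostep T T' \<Longrightarrow> tauo_step (ETApp e T) (ETApp e T')"
| "tauo_step e e' \<Longrightarrow> tauo_step (EApp e a) (EApp e' a)"
| "tauo_step e e' \<Longrightarrow> tauo_step (EApp a e) (EApp a e')"
| "tauo_step e e' \<Longrightarrow> tauo_step (ETApp e T) (ETApp e' T)"
| "tauo_step e e' \<Longrightarrow> tauo_step (ELam e) (ELam e')"
| "tauo_step e e' \<Longrightarrow> tauo_step (EMu e) (EMu e')"
| "tauo_step e e' \<Longrightarrow> tauo_step (ETLam e) (ETLam e')"

definition htauo_step :: "('k, 'f) evid \<Rightarrow> ('k, 'f) evid \<Rightarrow> bool" where
  "htauo_step e e' \<longleftrightarrow> head_step e e' \<or> tauo_step e e'"


section \<open>Erasure and hereditary head normalization\<close>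

datatype 'k raw =
    RVar nat
  | RCon 'k
  | RLam "'k raw"
  | RApp "'k raw" "'k raw"
  | RMu "'k raw"

primrec erase :: "('k, 'f) evid \<Rightarrow> 'k raw" where
  "erase (EVar i) = RVar i"
| "erase (ECon k) = RCon k"
| "erase (ELam e) = RLam (erase e)"
| "erase (EApp e e') = RApp (erase e) (erase e')"
| "erase (EMu e) = RMu (erase e)"
| "erase (ETApp e T) = erase e"
| "erase (ETLam e) = erase e"

primrec rlift :: "nat \<Rightarrow> 'k raw \<Rightarrow> 'k raw" where
  "rlift c (RVar i) = RVar (if i < c then i else Suc i)"
| "rlift c (RCon k) = RCon k"
| "rlift c (RLam e) = RLam (rlift (Suc c) e)"
| "rlift c (RApp e e') = RApp (rlift c e) (rlift c e')"
| "rlift c (RMu e) = RMu (rlift (Suc c) e)"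

primrec rsubst :: "nat \<Rightarrow> 'k raw \<Rightarrow> 'k raw \<Rightarrow> 'k raw" where
  "rsubst c s (RVar i) = (if i < c then RVar i else if i = c then s else RVar (i - 1))"
| "rsubst c s (RCon k) = RCon k"
| "rsubst c s (RLam e) = RLam (rsubst (Suc c) (rlift 0 s) e)"
| "rsubst c s (RApp e e') = RApp (rsubst c s e) (rsubst c s e')"
| "rsubst c s (RMu e) = RMu (rsubst (Suc c) (rlift 0 s) e)"

inductive bmu_step :: "'k raw \<Rightarrow> 'k raw \<Rightarrow> bool" where
  "bmu_step (RApp (RLam e) e') (rsubst 0 e' e)"
| "bmu_step (RMu e) (rsubst 0 (RMu e) e)"
| "bmu_step e e' \<Longrightarrow> bmu_step (RLam e) (RLam e')"
| "bmu_step e e' \<Longrightarrow> bmu_step (RApp e a) (RApp e' a)"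
| "bmu_step e e' \<Longrightarrow> bmu_step (RApp a e) (RApp a e')"
| "bmu_step e e' \<Longrightarrow> bmu_step (RMu e) (RMu e')"

primrec HN :: "nat \<Rightarrow> 'k raw set" where
  "HN 0 = UNIV"
| "HN (Suc n) = {e. \<exists>j h es. bmu_step\<^sup>*\<^sup>* e ((RLam ^^ j) (foldl RApp h es)) \<and>
     (h \<in> range RVar \<or> h \<in> range RCon) \<and> set es \<subseteq> HN n}"

definition HHN :: "('k, 'f) evid set" where
  "HHN = {e. \<forall>n. erase e \<in> HN n}"


section \<open>Evidence traces and their action on terms\<close>

text \<open>The positions \<open>o\<close> and \<open>s \<cdot> m\<close> are the natural numbers \<open>0\<close> and \<open>Suc m\<close>; a value \<open>\<kappa> T\<^sub>1 \<dots> T\<^sub>n\<close> of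
  the trace is the pair of \<open>\<kappa>\<close> and the list of the \<open>T\<^sub>i\<close>. The trace does not depend on the choice of the
  reduct, since reduction is confluent.\<close>

definition trace_form :: "('k, 'f) evid \<Rightarrow> 'k \<times> 'f ty list \<times> ('k, 'f) evid \<Rightarrow> bool" where
  "trace_form e q \<longleftrightarrow> (case q of (k, Ts, e') \<Rightarrow>
     htauo_step\<^sup>*\<^sup>* e (EApp (foldl ETApp (ECon k) Ts) e') \<and> (\<forall>T\<in>set Ts. onormal T))"

definition trace_next :: "('k, 'f) evid \<Rightarrow> ('k \<times> 'f ty list \<times> ('k, 'f) evid) option" where
  "trace_next e = (if \<exists>q. trace_form e q then Some (SOME q. trace_form e q) else None)"

primrec trace :: "nat \<Rightarrow> ('k, 'f) evid \<Rightarrow> ('k \<times> 'f ty list) option" where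
  "trace 0 e = map_option (\<lambda>(k, Ts, e'). (k, Ts)) (trace_next e)"
| "trace (Suc m) e = Option.bind (trace_next e) (\<lambda>(k, Ts, e'). trace m e')"

text \<open>The body \<open>C[x,\<dots>,x]\<close> of \<open>\<lambda>x. C[x,\<dots>,x]\<close>: the bound \<open>x\<close> has index 0, so the variables of \<open>C\<close> are
  shifted.\<close>

fun ctxt_body :: "'f ctxt \<Rightarrow> 'f ty" where
  "ctxt_body Hole = TVar 0"
| "ctxt_body (CVar x) = TVar (Suc x)"
| "ctxt_body (CFun f Cs) = foldl TApp (TFun f) (map ctxt_body Cs)"

text \<open>Normal types of kind \<open>* \<Rightarrow> *\<close> need not be abstractions: \<open>F t\<^sub>1 \<dots> t\<^sub>n\<close> with \<open>F\<close> of arity \<open>n + 1\<close>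
  is one as well and stands for its eta-expansion \<open>\<lambda>x. F t\<^sub>1 \<dots> t\<^sub>n x\<close>.\<close>

definition denotes_ctxt :: "'f ty \<Rightarrow> 'f ctxt \<Rightarrow> bool" where
  "denotes_ctxt P C \<longleftrightarrow> P = TLam (ctxt_body C) \<or> TApp (tlift 0 P) (TVar 0) = ctxt_body C"

inductive acts :: "('k \<rightharpoonup> 'f rule) \<Rightarrow> ('k, 'f) evid \<Rightarrow> nat \<Rightarrow> 'f trm \<Rightarrow> 'f trm \<Rightarrow> bool" for R e m where
  "trace m e = Some (k, P # map ty_of ts) \<Longrightarrow> denotes_ctxt P C \<Longrightarrow> R k = Some (l, r) \<Longrightarrow>
   length ts = length (fv_list l) \<Longrightarrow>
   \<sigma> = (\<lambda>x. case map_of (zip (fv_list l) ts) x of Some t \<Rightarrow> t | None \<Rightarrow> Var x) \<Longrightarrow>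
   acts R e m (fill C (replicate (holes C) (subst \<sigma> l))) (fill C (replicate (holes C) (subst \<sigma> r)))"

definition action :: "('k \<rightharpoonup> 'f rule) \<Rightarrow> ('k, 'f) evid \<Rightarrow> nat \<Rightarrow> 'f trm \<rightharpoonup> 'f trm" where
  "action R e m t = (if \<exists>u. acts R e m t u then Some (THE u. acts R e m t u) else None)"

end

theory Submission
  imports Defs "HOL-Library.Confluence"
begin

text \<open>Hereditary head normalization speaks of arbitrary reductions of erased terms, while the
  trace allows only head steps and type steps of typed evidence. Weak head steps are the ones that
  typed evidence can imitate: an erased beta redex can be hidden only behind type redexes, since
  typing forbids both applying a type abstraction to evidence and instantiating an evidence
  abstraction. The trace picks some reduct of the required form. The facts about its entries are
  therefore proved for every such reduct, and it is confluence of erased terms that carries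
  \<open>HN\<close> along the chosen reduction. The other obstacle is \<open>Conv\<close>: inversion
  yields types only up to conversion. Two things make syntactic comparison possible again. Outermost
  implications and quantifiers are stable under reduction, so the prefix of a Leibniz type can be
  followed exactly; and kinded types have normal forms, as arguments of kind \<open>Star\<close> are
  never abstractions.\<close>

text \<open>By standardization, weak head reduction of the erasure of \<open>e\<close> terminates. Each of its steps is the image
  of a step on the well-typed evidence, after contracting the type redexes in front of it. By subject
  reduction the result has the type \<open>t\<close>, which converts neither to an implication nor to a quantification;
  in the empty context this leaves only \<open>\<kappa> P t\<^sub>1 \<dots> t\<^sub>n e'\<close>, where \<open>P (\<sigma> l)\<close> converts to \<open>t\<close>.
  The arguments being normal, comparison of normal forms makes \<open>P\<close> a context \<open>C\<close> and the \<open>t\<^sub>i\<close>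
  first-order terms with \<open>t = C[\<sigma> l, \<dots>, \<sigma> l]\<close>: relevance of \<open>\<lambda>\<close> and \<open>FV(r) \<subseteq> FV(l)\<close> ensure that
  nothing is hidden by erased variables. Then \<open>e'\<close> has the type \<open>C[\<sigma> r, \<dots>, \<sigma> r]\<close> and, reduction being
  confluent, is again hereditarily head normalizing, so the argument repeats.\<close>

section \<open>Erased evidence\<close>

subsection \<open>Lifting and substitution\<close>

lemma rlift_rlift: "i \<le> k \<Longrightarrow> rlift (Suc k) (rlift i t) = rlift i (rlift k t)"
  by (induct t arbitrary: i k) auto

lemma rlift_rsubst_ge: "j \<le> i \<Longrightarrow> rlift i (rsubst j s t) = rsubst j (rlift i s) (rlift (Suc i) t)"
  by (induct t arbitrary: i j s) (auto simp: rlift_rlift split: if_splits)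

lemma rlift_rsubst_le: "i \<le> j \<Longrightarrow> rlift i (rsubst j s t) = rsubst (Suc j) (rlift i s) (rlift i t)"
  by (induct t arbitrary: i j s) (auto simp: rlift_rlift)

lemma rsubst_rlift [simp]: "rsubst k s (rlift k t) = t"
  by (induct t arbitrary: k s) auto

lemma rsubst_rsubst:
  "i \<le> j \<Longrightarrow> rsubst j v (rsubst i u t) = rsubst i (rsubst j v u) (rsubst (Suc j) (rlift i v) t)"
  by (induct t arbitrary: i j u v)
    (auto simp: rlift_rlift rlift_rsubst_le simp flip: rlift_rlift)

subsection \<open>Confluence\<close>

text \<open>Parallel reduction in the manner of Tait and Martin-Loef. In \<open>par_unfold\<close>
  the same reduct \<open>a'\<close> serves as the body and inside the copy put in for the variable,
  so \<open>par_rsubst\<close> also covers the unfolding.\<close>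

inductive par :: "'k raw \<Rightarrow> 'k raw \<Rightarrow> bool" where
  par_var: "par (RVar i) (RVar i)"
| par_con: "par (RCon k) (RCon k)"
| par_lam: "par a a' \<Longrightarrow> par (RLam a) (RLam a')"
| par_app: "par a a' \<Longrightarrow> par b b' \<Longrightarrow> par (RApp a b) (RApp a' b')"
| par_mu: "par a a' \<Longrightarrow> par (RMu a) (RMu a')"
| par_beta: "par a a' \<Longrightarrow> par b b' \<Longrightarrow> par (RApp (RLam a) b) (rsubst 0 b' a')"
| par_unfold: "par a a' \<Longrightarrow> par (RMu a) (rsubst 0 (RMu a') a')"

inductive_cases par_LamE: "par (RLam a) e"

lemma par_refl [simp]: "par e e"
  by (induct e) (auto intro: par.intros)

lemma par_rlift: "par a a' \<Longrightarrow> par (rlift c a) (rlift c a')"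
proof (induct arbitrary: c rule: par.induct)
  case (par_beta a a' b b')
  then show ?case
    by (simp add: rlift_rsubst_ge par.par_beta)
next
  case (par_unfold a a')
  then have "par (RMu (rlift (Suc c) a)) (rsubst 0 (RMu (rlift (Suc c) a')) (rlift (Suc c) a'))"
    by (intro par.par_unfold)
  then show ?case by (simp add: rlift_rsubst_ge)
qed (auto intro: par.intros)

lemma par_rsubst: "par a a' \<Longrightarrow> par s s' \<Longrightarrow> par (rsubst c s a) (rsubst c s' a')"
proof (induct arbitrary: c s s' rule: par.induct)
  case (par_beta a a' b b')
  then have "par (RApp (RLam (rsubst (Suc c) (rlift 0 s) a)) (rsubst c s b))
     (rsubst 0 (rsubst c s' b') (rsubst (Suc c) (rlift 0 s') a'))"
    by (intro par.par_beta) (auto intro: par_rlift)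
  then show ?case by (simp add: rsubst_rsubst)
next
  case (par_unfold a a')
  then have "par (RMu (rsubst (Suc c) (rlift 0 s) a))
     (rsubst 0 (RMu (rsubst (Suc c) (rlift 0 s') a')) (rsubst (Suc c) (rlift 0 s') a'))"
    by (intro par.par_unfold) (auto intro: par_rlift)
  then show ?case by (simp add: rsubst_rsubst)
next
  case (par_lam a a')
  show ?case by (simp add: par.par_lam par_lam(2) par_rlift par_lam(3))
next
  case (par_mu a a')
  show ?case by (simp add: par.par_mu par_mu(2) par_rlift par_mu(3))
qed (auto intro: par.intros)

text \<open>Takahashi's complete development: all redexes already present are contracted, each
  \<open>RMu\<close> being unfolded once.\<close>

fun complete_dev :: "'k raw \<Rightarrow> 'k raw" where
  "complete_dev (RVar i) = RVar i"
| "complete_dev (RCon k) = RCon k"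
| "complete_dev (RLam a) = RLam (complete_dev a)"
| "complete_dev (RApp (RLam a) b) = rsubst 0 (complete_dev b) (complete_dev a)"
| "complete_dev (RApp a b) = RApp (complete_dev a) (complete_dev b)"
| "complete_dev (RMu a) = rsubst 0 (RMu (complete_dev a)) (complete_dev a)"

text \<open>Triangle property: the target depends on the source alone, so any two parallel steps
  from one term meet there.\<close>

lemma par_complete_dev: "par e e' \<Longrightarrow> par e' (complete_dev e)"
proof (induct rule: par.induct)
  case (par_app a a' b b')
  show ?case
  proof (cases "\<exists>c. a = RLam c")
    case True
    with par_app show ?thesis
      by (auto elim!: par_LamE intro: par.intros)
  next
    case False
    then have "complete_dev (RApp a b) = RApp (complete_dev a) (complete_dev b)"
      by (cases a) auto
    with par_app show ?thesis by (auto intro: par.intros)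
  qed
qed (auto intro: par.intros par_rsubst)

lemma bmu_step_imp_par: "bmu_step e e' \<Longrightarrow> par e e'"
  by (induct rule: bmu_step.induct) (auto intro: par.intros)

lemma bmu_steps_Lam: "bmu_step\<^sup>*\<^sup>* a a' \<Longrightarrow> bmu_step\<^sup>*\<^sup>* (RLam a) (RLam a')"
  by (induct rule: rtranclp_induct) (auto intro: rtranclp.rtrancl_into_rtrancl bmu_step.intros)

lemma bmu_steps_Mu: "bmu_step\<^sup>*\<^sup>* a a' \<Longrightarrow> bmu_step\<^sup>*\<^sup>* (RMu a) (RMu a')"
  by (induct rule: rtranclp_induct) (auto intro: rtranclp.rtrancl_into_rtrancl bmu_step.intros)

lemma bmu_steps_AppL: "bmu_step\<^sup>*\<^sup>* a a' \<Longrightarrow> bmu_step\<^sup>*\<^sup>* (RApp a b) (RApp a' b)"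
  by (induct rule: rtranclp_induct) (auto intro: rtranclp.rtrancl_into_rtrancl bmu_step.intros)

lemma bmu_steps_AppR: "bmu_step\<^sup>*\<^sup>* b b' \<Longrightarrow> bmu_step\<^sup>*\<^sup>* (RApp a b) (RApp a b')"
  by (induct rule: rtranclp_induct) (auto intro: rtranclp.rtrancl_into_rtrancl bmu_step.intros)

lemma bmu_steps_App:
  "bmu_step\<^sup>*\<^sup>* a a' \<Longrightarrow> bmu_step\<^sup>*\<^sup>* b b' \<Longrightarrow> bmu_step\<^sup>*\<^sup>* (RApp a b) (RApp a' b')"
  by (blast intro: rtranclp_trans bmu_steps_AppL bmu_steps_AppR)

lemma par_imp_bmu_steps: "par e e' \<Longrightarrow> bmu_step\<^sup>*\<^sup>* e e'"
proof (induct rule: par.induct)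
  case (par_beta a a' b b')
  then have "bmu_step\<^sup>*\<^sup>* (RApp (RLam a) b) (RApp (RLam a') b')"
    by (intro bmu_steps_App bmu_steps_Lam)
  then show ?case
    by (rule rtranclp.rtrancl_into_rtrancl) (rule bmu_step.intros)
next
  case (par_unfold a a')
  then have "bmu_step\<^sup>*\<^sup>* (RMu a) (RMu a')"
    by (intro bmu_steps_Mu)
  then show ?case
    by (rule rtranclp.rtrancl_into_rtrancl) (rule bmu_step.intros)
qed (auto intro: bmu_steps_App bmu_steps_Lam bmu_steps_Mu)

lemma confluentp_bmu_step: "confluentp bmu_step"
proof -
  have "confluentp par"
    by (intro strong_confluentp_imp_confluentp strong_confluentpI) (blast intro: par_complete_dev)
  moreover have "par\<^sup>*\<^sup>* = bmu_step\<^sup>*\<^sup>*"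
    by (rule rtranclp_subset) (auto intro: bmu_step_imp_par par_imp_bmu_steps)
  ultimately show ?thesis
    unfolding confluentp_conv_strong_confluentp_rtranclp by metis
qed

subsection \<open>Hereditary head normalization is invariant under reduction\<close>

definition is_atom :: "'k raw \<Rightarrow> bool" where
  "is_atom h \<longleftrightarrow> h \<in> range RVar \<or> h \<in> range RCon"

text \<open>An atomic head never takes part in a redex, so all activity stays in the arguments. The
  closure in \<open>list_all2\<close> lets untouched arguments count as reduced.\<close>

lemma bmu_step_atom_spine:
  "bmu_step (foldl RApp h es) e \<Longrightarrow> is_atom h \<Longrightarrow>
   \<exists>es'. e = foldl RApp h es' \<and> list_all2 bmu_step\<^sup>*\<^sup>* es es'"
proof (induct es arbitrary: e rule: rev_induct)
  case Nil
  then show ?case by (auto simp: is_atom_def elim: bmu_step.cases)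
next
  case (snoc x es)
  from snoc.prems(1) have "bmu_step (RApp (foldl RApp h es) x) e" by simp
  then show ?case
  proof cases
    case (1 a)
    with snoc.prems(2) show ?thesis by (cases es rule: rev_cases) (auto simp: is_atom_def)
  next
    case (4 a)
    from snoc.hyps[OF this(2) snoc.prems(2)] obtain es' where
      "a = foldl RApp h es'" "list_all2 bmu_step\<^sup>*\<^sup>* es es'" by blast
    with 4 show ?thesis by (intro exI[of _ "es' @ [x]"]) (auto simp: list_all2_appendI)
  next
    case (5 x')
    then show ?thesis
      by (intro exI[of _ "es @ [x']"]) (auto intro!: list_all2_appendI list_all2_refl)
  qed
qed

lemma bmu_steps_atom_spine:
  "bmu_step\<^sup>*\<^sup>* (foldl RApp h es) e \<Longrightarrow> is_atom h \<Longrightarrow>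
   \<exists>es'. e = foldl RApp h es' \<and> list_all2 bmu_step\<^sup>*\<^sup>* es es'"
proof (induct rule: rtranclp_induct)
  case base
  then show ?case by (auto intro: list_all2_refl)
next
  case (step y z)
  then obtain es' where es': "y = foldl RApp h es'" "list_all2 bmu_step\<^sup>*\<^sup>* es es'" by blast
  from step(2) bmu_step_atom_spine[OF _ step(4)] obtain es'' where
    es'': "z = foldl RApp h es''" "list_all2 bmu_step\<^sup>*\<^sup>* es' es''" unfolding es'(1) by metis
  have "list_all2 bmu_step\<^sup>*\<^sup>* es es''"
    by (rule list_all2_trans[OF _ es'(2) es''(2)]) (rule rtranclp_trans)
  with es''(1) show ?case by blast
qed

lemma bmu_steps_LamD: "bmu_step\<^sup>*\<^sup>* (RLam a) e \<Longrightarrow> \<exists>a'. e = RLam a' \<and> bmu_step\<^sup>*\<^sup>* a a'"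
  by (induct rule: rtranclp_induct) (auto elim: bmu_step.cases intro: rtranclp.rtrancl_into_rtrancl)

lemma bmu_steps_Lams:
  "bmu_step\<^sup>*\<^sup>* ((RLam ^^ j) a) e \<Longrightarrow> \<exists>a'. e = (RLam ^^ j) a' \<and> bmu_step\<^sup>*\<^sup>* a a'"
  by (induct j arbitrary: e) (auto dest: bmu_steps_LamD)

lemma HN_Suc_iff:
  "e \<in> HN (Suc n) \<longleftrightarrow> (\<exists>j h es. bmu_step\<^sup>*\<^sup>* e ((RLam ^^ j) (foldl RApp h es)) \<and>
     is_atom h \<and> set es \<subseteq> HN n)"
  by (simp add: is_atom_def)

declare HN.simps(2) [simp del]

lemma HN_SucE:
  assumes "e \<in> HN (Suc n)"
  obtains j h es where "bmu_step\<^sup>*\<^sup>* e ((RLam ^^ j) (foldl RApp h es))" "is_atom h" "set es \<subseteq> HN n"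
  using assms unfolding HN_Suc_iff by (elim exE conjE)

lemma HN_SucI:
  "bmu_step\<^sup>*\<^sup>* e ((RLam ^^ j) (foldl RApp h es)) \<Longrightarrow> is_atom h \<Longrightarrow> set es \<subseteq> HN n \<Longrightarrow> e \<in> HN (Suc n)"
  unfolding HN_Suc_iff by (intro exI conjI)

text \<open>Confluence joins \<open>e'\<close> with the head normal form of \<open>e\<close>.
  Reduction keeps the abstractions and the atomic head of the latter, and the induction hypothesis
  follows its arguments.\<close>

lemma HN_forward: "e \<in> HN n \<Longrightarrow> bmu_step\<^sup>*\<^sup>* e e' \<Longrightarrow> e' \<in> HN n"
proof (induct n arbitrary: e e')
  case (Suc n)
  from Suc.prems(1) obtain j h es where
    red: "bmu_step\<^sup>*\<^sup>* e ((RLam ^^ j) (foldl RApp h es))" and h: "is_atom h" and es: "set es \<subseteq> HN n"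
    by (rule HN_SucE)
  from confluentpD[OF confluentp_bmu_step red Suc.prems(2)] obtain d where
    d: "bmu_step\<^sup>*\<^sup>* ((RLam ^^ j) (foldl RApp h es)) d" "bmu_step\<^sup>*\<^sup>* e' d" by blast
  from bmu_steps_Lams[OF d(1)] bmu_steps_atom_spine[OF _ h] obtain es' where
    es': "d = (RLam ^^ j) (foldl RApp h es')" "list_all2 bmu_step\<^sup>*\<^sup>* es es'" by blast
  have "set es' \<subseteq> HN n"
  proof
    fix x' assume "x' \<in> set es'"
    with es'(2) obtain x where "x \<in> set es" "bmu_step\<^sup>*\<^sup>* x x'"
      unfolding list_all2_conv_all_nth by (metis in_set_conv_nth)
    with es Suc.hyps show "x' \<in> HN n" by blast
  qed
  with d(2) h show ?case unfolding es'(1) by (intro HN_SucI)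
qed auto

lemma HN_backward: "bmu_step\<^sup>*\<^sup>* e e' \<Longrightarrow> e' \<in> HN n \<Longrightarrow> e \<in> HN n"
  by (cases n) (auto elim!: HN_SucE intro: HN_SucI[OF rtranclp_trans])

text \<open>A constant applied to \<open>e\<close> can reduce only inside \<open>e\<close>, so the
  witnessing spine has a reduct of \<open>e\<close> as its argument, and \<open>HN_backward\<close>
  leads back to \<open>e\<close>. One level is lost, which is harmless for membership at all
  levels.\<close>

lemma HN_Con_AppD:
  assumes "RApp (RCon k) e \<in> HN (Suc n)"
  shows "e \<in> HN n"
proof -
  from assms have "foldl RApp (RCon k) [e] \<in> HN (Suc n)" by simp
  then obtain j h es where
    red: "bmu_step\<^sup>*\<^sup>* (foldl RApp (RCon k) [e]) ((RLam ^^ j) (foldl RApp h es))"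
      and h: "is_atom h" and es: "set es \<subseteq> HN n"
    by (rule HN_SucE)
  from bmu_steps_atom_spine[OF red] obtain e' where
    eq: "(RLam ^^ j) (foldl RApp h es) = RApp (RCon k) e'" and e': "bmu_step\<^sup>*\<^sup>* e e'"
    by (auto simp: is_atom_def list_all2_Cons1)
  from eq have "j = 0" by (cases j) auto
  with eq h have "e' \<in> set es" by (cases es rule: rev_cases) (auto simp: is_atom_def)
  with es e' show ?thesis by (blast intro: HN_backward)
qed

subsection \<open>Standardization\<close>

text \<open>Abstractions are not entered: evidence of a first-order type cannot end in one, so the
  weak strategy reaches every head that the trace needs.\<close>

inductive wh_step :: "'k raw \<Rightarrow> 'k raw \<Rightarrow> bool" where
  wh_beta: "wh_step (RApp (RLam a) b) (rsubst 0 b a)"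
| wh_unfold: "wh_step (RMu a) (rsubst 0 (RMu a) a)"
| wh_app: "wh_step a a' \<Longrightarrow> wh_step (RApp a b) (RApp a' b)"

lemma wh_steps_App: "wh_step\<^sup>*\<^sup>* a a' \<Longrightarrow> wh_step\<^sup>*\<^sup>* (RApp a b) (RApp a' b)"
  by (induct rule: rtranclp_induct) (auto intro: rtranclp.rtrancl_into_rtrancl wh_step.intros)

lemma wh_step_rlift: "wh_step a a' \<Longrightarrow> wh_step (rlift c a) (rlift c a')"
proof (induct rule: wh_step.induct)
  case (wh_unfold a)
  have "wh_step (RMu (rlift (Suc c) a)) (rsubst 0 (RMu (rlift (Suc c) a)) (rlift (Suc c) a))"
    by (rule wh_step.wh_unfold)
  then show ?case by (simp add: rlift_rsubst_ge)
qed (auto simp: rlift_rsubst_ge intro: wh_step.intros)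

lemma wh_step_rsubst: "wh_step a a' \<Longrightarrow> wh_step (rsubst c s a) (rsubst c s a')"
proof (induct rule: wh_step.induct)
  case (wh_unfold a)
  let ?a = "rsubst (Suc c) (rlift 0 s) a"
  have "wh_step (RMu ?a) (rsubst 0 (RMu ?a) ?a)"
    by (rule wh_step.wh_unfold)
  then show ?case by (simp add: rsubst_rsubst)
qed (auto simp: rsubst_rsubst intro: wh_step.intros)

lemma wh_steps_rlift: "wh_step\<^sup>*\<^sup>* a a' \<Longrightarrow> wh_step\<^sup>*\<^sup>* (rlift c a) (rlift c a')"
  by (induct rule: rtranclp_induct) (auto intro: rtranclp.rtrancl_into_rtrancl wh_step_rlift)

lemma wh_steps_rsubst: "wh_step\<^sup>*\<^sup>* a a' \<Longrightarrow> wh_step\<^sup>*\<^sup>* (rsubst c s a) (rsubst c s a')"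
  by (induct rule: rtranclp_induct) (auto intro: rtranclp.rtrancl_into_rtrancl wh_step_rsubst)

text \<open>Standard reductions, in the style of Loader and Kashima.\<close>

inductive std :: "'k raw \<Rightarrow> 'k raw \<Rightarrow> bool" where
  std_var: "wh_step\<^sup>*\<^sup>* e (RVar i) \<Longrightarrow> std e (RVar i)"
| std_con: "wh_step\<^sup>*\<^sup>* e (RCon k) \<Longrightarrow> std e (RCon k)"
| std_lam: "wh_step\<^sup>*\<^sup>* e (RLam a) \<Longrightarrow> std a a' \<Longrightarrow> std e (RLam a')"
| std_app: "wh_step\<^sup>*\<^sup>* e (RApp a b) \<Longrightarrow> std a a' \<Longrightarrow> std b b' \<Longrightarrow> std e (RApp a' b')"
| std_mu: "wh_step\<^sup>*\<^sup>* e (RMu a) \<Longrightarrow> std a a' \<Longrightarrow> std e (RMu a')"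

inductive_cases std_VarE: "std e (RVar i)"
inductive_cases std_ConE: "std e (RCon k)"
inductive_cases std_LamE: "std e (RLam a)"
inductive_cases std_AppE: "std e (RApp a b)"
inductive_cases std_MuE: "std e (RMu a)"

lemma std_refl: "std e e"
  by (induct e) (auto intro: std.intros)

lemma wh_steps_std: "wh_step\<^sup>*\<^sup>* e d \<Longrightarrow> std d e' \<Longrightarrow> std e e'"
  by (erule std.cases) (auto intro: std.intros rtranclp_trans)

lemma std_rlift: "std e e' \<Longrightarrow> std (rlift c e) (rlift c e')"
proof (induct arbitrary: c rule: std.induct)
  case (std_var e i)
  from wh_steps_rlift[OF this, of c] show ?case
    by (auto intro: std.intros)
next
  case (std_con e k)
  from wh_steps_rlift[OF this, of c] show ?case
    by (auto intro: std.intros)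
next
  case (std_lam e a a')
  from wh_steps_rlift[OF this(1), of c] std_lam(3) show ?case
    by (auto intro: std.intros)
next
  case (std_app e a b a' b')
  from wh_steps_rlift[OF this(1), of c] std_app(3,5) show ?case
    by (auto intro: std.intros)
next
  case (std_mu e a a')
  from wh_steps_rlift[OF this(1), of c] std_mu(3) show ?case
    by (auto intro: std.intros)
qed

lemma std_rsubst: "std e e' \<Longrightarrow> std s s' \<Longrightarrow> std (rsubst c s e) (rsubst c s' e')"
proof (induct arbitrary: c s s' rule: std.induct)
  \<comment> \<open>If \<open>e\<close> reaches the substituted variable, weak head reduction now
    leads to \<open>s\<close>, and the standard reduction of \<open>s\<close> is appended by
    \<open>wh_steps_std\<close>.\<close>
  case (std_var e i)
  from wh_steps_rsubst[OF this(1), of c s] std_var(2) show ?case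
    by (auto intro: wh_steps_std std_refl)
next
  case (std_con e k)
  from wh_steps_rsubst[OF this(1), of c s] show ?case
    by (auto intro: std.intros)
next
  case (std_lam e a a')
  from wh_steps_rsubst[OF this(1), of c s] std_lam(3)[OF std_rlift[OF std_lam(4)]] show ?case
    by (auto intro: std.intros)
next
  case (std_app e a b a' b')
  from wh_steps_rsubst[OF this(1), of c s] std_app(3,5)[OF std_app(6)] show ?case
    by (auto intro: std.intros)
next
  case (std_mu e a a')
  from wh_steps_rsubst[OF this(1), of c s] std_mu(3)[OF std_rlift[OF std_mu(4)]] show ?case
    by (auto intro: std.intros)
qed

text \<open>A redex at the end of a standard reduction stems from one that weak head reduction
  exposes. It is contracted there, and \<open>std_rsubst\<close> combines the remaining standard
  reductions of its parts.\<close>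

lemma std_step: "bmu_step e' e'' \<Longrightarrow> std e e' \<Longrightarrow> std e e''"
proof (induct arbitrary: e rule: bmu_step.induct)
  case (1 a' b')
  then obtain e1 b a where red: "wh_step\<^sup>*\<^sup>* e (RApp e1 b)" "wh_step\<^sup>*\<^sup>* e1 (RLam a)"
    and st: "std b b'" "std a a'"
    by (auto elim!: std_AppE std_LamE)
  have "wh_step\<^sup>*\<^sup>* (RApp e1 b) (rsubst 0 b a)"
    using wh_steps_App[OF red(2)] by (rule rtranclp.rtrancl_into_rtrancl) (rule wh_beta)
  with red(1) have "wh_step\<^sup>*\<^sup>* e (rsubst 0 b a)" by (rule rtranclp_trans)
  with st show ?case by (blast intro: wh_steps_std std_rsubst)
next
  case (2 a')
  then obtain a where red: "wh_step\<^sup>*\<^sup>* e (RMu a)" and st: "std a a'"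
    by (auto elim!: std_MuE)
  have "wh_step\<^sup>*\<^sup>* e (rsubst 0 (RMu a) a)"
    using red by (rule rtranclp.rtrancl_into_rtrancl) (rule wh_unfold)
  moreover have "std (RMu a) (RMu a')" using st by (auto intro: std.intros)
  ultimately show ?case using st by (blast intro: wh_steps_std std_rsubst)
qed (auto elim!: std_LamE std_AppE std_MuE intro: std.intros)

theorem standardization: "bmu_step\<^sup>*\<^sup>* e e' \<Longrightarrow> std e e'"
  by (induct rule: rtranclp_induct) (auto intro: std_refl std_step)

text \<open>Only the weak head prefix of each layer is kept, so \<open>es'\<close> holds the
  arguments as they were before their own reductions.\<close>

lemma std_spine:
  "std e (foldl RApp h es) \<Longrightarrow> is_atom h \<Longrightarrow> \<exists>es'. wh_step\<^sup>*\<^sup>* e (foldl RApp h es')"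
proof (induct es arbitrary: e rule: rev_induct)
  case Nil
  then show ?case by (auto simp: is_atom_def elim!: std_VarE std_ConE intro: exI[of _ "[]"])
next
  case (snoc x es)
  then obtain a b where "wh_step\<^sup>*\<^sup>* e (RApp a b)" "std a (foldl RApp h es)"
    by (auto elim!: std_AppE)
  moreover from snoc.hyps[OF this(2) snoc.prems(2)] obtain es' where
    "wh_step\<^sup>*\<^sup>* a (foldl RApp h es')" by blast
  ultimately show ?case
    by (intro exI[of _ "es' @ [b]"]) (auto intro: rtranclp_trans wh_steps_App)
qed

lemma HN_weak_head_normalizing:
  assumes "e \<in> HN (Suc n)"
  shows "(\<exists>a. wh_step\<^sup>*\<^sup>* e (RLam a)) \<or> (\<exists>h es. is_atom h \<and> wh_step\<^sup>*\<^sup>* e (foldl RApp h es))"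
proof -
  from assms obtain j h es where
    red: "bmu_step\<^sup>*\<^sup>* e ((RLam ^^ j) (foldl RApp h es))" and h: "is_atom h"
    by (rule HN_SucE)
  from standardization[OF red] have "std e ((RLam ^^ j) (foldl RApp h es))" .
  \<comment> \<open>For positive \<open>j\<close> weak head reduction already stops at the outermost
    abstraction; for \<open>j = 0\<close> it stops at the spine.\<close>
  with h show ?thesis
    by (cases j) (auto elim!: std_LamE dest!: std_spine)
qed

section \<open>Types\<close>

subsection \<open>Encoding of types as erased evidence\<close>

text \<open>Since \<open>\<rightarrow>\<^sub>o\<close> is \<open>\<beta>\<close>-reduction below extra constructors, representing these constructors by
  constants transfers the substitution lemmas and confluence from erased evidence to types.\<close>

primrec encode :: "'f ty \<Rightarrow> ('f + kind option) raw" where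
  "encode (TFun f) = RCon (Inl f)"
| "encode (TVar i) = RVar i"
| "encode (TLam T) = RLam (encode T)"
| "encode (TAll K T) = RApp (RCon (Inr (Some K))) (RLam (encode T))"
| "encode (TApp T T') = RApp (encode T) (encode T')"
| "encode (TImp T T') = RApp (RApp (RCon (Inr None)) (encode T)) (encode T')"

lemma encode_tlift [simp]: "encode (tlift c T) = rlift c (encode T)"
  by (induct T arbitrary: c) auto

lemma encode_tsubst [simp]: "encode (tsubst c S T) = rsubst c (encode S) (encode T)"
  by (induct T arbitrary: c S) auto

lemma encode_eq_iffs [simp]:
  "encode T = RCon k \<longleftrightarrow> (\<exists>f. k = Inl f \<and> T = TFun f)"
  "encode T = RVar i \<longleftrightarrow> T = TVar i"
  "encode T = RLam a \<longleftrightarrow> (\<exists>T'. T = TLam T' \<and> a = encode T')"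
  by (cases T; auto)+

text \<open>Half an implication encodes no type; this keeps implications apart from applications in
  \<open>encode_eqD\<close>.\<close>

lemma encode_neq_Imp [simp]: "encode T \<noteq> RApp (RCon (Inr None)) a"
  by (cases T) auto

declare encode_eq_iffs [THEN eq_iff_swap, simp]

lemma encode_eqD: "encode T = encode T' \<Longrightarrow> T = T'"
proof (induct T arbitrary: T')
  case (TLam T)
  from TLam.prems show ?case by (cases T') (auto dest!: TLam.hyps)
next
  case (TAll K T)
  from TAll.prems show ?case by (cases T') (auto dest!: TAll.hyps)
next
  case (TApp T S)
  from TApp.prems show ?case by (cases T') (auto dest!: TApp.hyps)
next
  case (TImp T S)
  from TImp.prems show ?case
    by (cases T') (auto dest!: TImp.hyps simp: encode_neq_Imp[symmetric])
qed auto

lemma tlift_tlift: "i \<le> k \<Longrightarrow> tlift (Suc k) (tlift i T) = tlift i (tlift k T)"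
  by (rule encode_eqD) (simp add: rlift_rlift)

lemma tlift_tsubst_ge: "j \<le> i \<Longrightarrow> tlift i (tsubst j S T) = tsubst j (tlift i S) (tlift (Suc i) T)"
  by (rule encode_eqD) (simp add: rlift_rsubst_ge)

lemma tlift_tsubst_le: "i \<le> j \<Longrightarrow> tlift i (tsubst j S T) = tsubst (Suc j) (tlift i S) (tlift i T)"
  by (rule encode_eqD) (simp add: rlift_rsubst_le)

lemma tsubst_tlift [simp]: "tsubst k S (tlift k T) = T"
  by (rule encode_eqD) simp

lemma tsubst_tsubst:
  "i \<le> j \<Longrightarrow> tsubst j V (tsubst i U T) = tsubst i (tsubst j V U) (tsubst (Suc j) (tlift i V) T)"
  by (rule encode_eqD) (simp add: rsubst_rsubst)

inductive_cases ostep_TFunE: "ostep (TFun f) T"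
inductive_cases ostep_TVarE: "ostep (TVar x) T"
inductive_cases ostep_TLamE: "ostep (TLam T) T'"
inductive_cases ostep_TAllE: "ostep (TAll K T) T'"
inductive_cases ostep_TAppE: "ostep (TApp T S) T'"
inductive_cases ostep_TImpE: "ostep (TImp T S) T'"

lemma ostep_encode: "ostep T T' \<Longrightarrow> bmu_step (encode T) (encode T')"
  by (induct rule: ostep.induct) (auto intro: bmu_step.intros)

text \<open>The code of a type contains no \<open>RMu\<close>, and the added constants are never
  abstractions, so the only redexes are those of the type.\<close>

lemma bmu_step_encodeD: "bmu_step (encode T) e \<Longrightarrow> \<exists>T'. e = encode T' \<and> ostep T T'"
proof (induct T arbitrary: e)
  case (TLam T)
  from TLam.prems show ?case
    by (auto elim!: bmu_step.cases dest!: TLam.hyps intro: ostep.intros encode.simps[symmetric])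
next
  case (TAll K T)
  from TAll.prems obtain a where "bmu_step (encode T) a" "e = RApp (RCon (Inr (Some K))) (RLam a)"
    by (auto elim: bmu_step.cases)
  with TAll.hyps show ?case
    by (metis encode.simps(4) ostep.intros(3))
next
  case (TApp T S)
  from TApp.prems show ?case
  proof (cases rule: bmu_step.cases)
    case (1 a b)
    then show ?thesis by simp (metis encode_eq_iffs(3) encode_tsubst ostep.intros(1))
  next
    case (4 a a' b)
    with TApp.hyps(1) show ?thesis by simp (metis encode.simps(5) ostep.intros(4))
  next
    case (5 a a' b)
    with TApp.hyps(2) show ?thesis by simp (metis encode.simps(5) ostep.intros(5))
  qed auto
next
  case (TImp T S)
  from TImp.prems consider
      a where "bmu_step (encode T) a" "e = RApp (RApp (RCon (Inr None)) a) (encode S)"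
    | a where "bmu_step (encode S) a" "e = RApp (RApp (RCon (Inr None)) (encode T)) a"
    by (auto elim!: bmu_step.cases[of "RApp _ _"] bmu_step.cases[of "RCon _"])
  then show ?case
    by cases (metis TImp.hyps encode.simps(6) ostep.intros(6,7))+
qed (auto elim: bmu_step.cases)

subsection \<open>Conversion\<close>

text \<open>Codes of types are closed under reduction and \<open>encode\<close> is injective, so a
  common reduct of two codes is the code of a common reduct.\<close>

lemma confluentp_ostep: "confluentp ostep"
proof (rule confluentpI)
  have fwd: "bmu_step\<^sup>*\<^sup>* (encode T) (encode T')" if "ostep\<^sup>*\<^sup>* T T'" for T T' :: "'a ty"
    using that by induct (auto intro: ostep_encode rtranclp.rtrancl_into_rtrancl)
  have bwd: "\<exists>T'. e = encode T' \<and> ostep\<^sup>*\<^sup>* T T'" if "bmu_step\<^sup>*\<^sup>* (encode T) e" for T :: "'a ty" and e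
    using that by induct (auto dest!: bmu_step_encodeD intro: rtranclp.rtrancl_into_rtrancl)
  fix T U V :: "'a ty"
  assume "ostep\<^sup>*\<^sup>* T U" "ostep\<^sup>*\<^sup>* T V"
  from confluentpD[OF confluentp_bmu_step fwd[OF this(1)] fwd[OF this(2)]] obtain e where
    "bmu_step\<^sup>*\<^sup>* (encode U) e" "bmu_step\<^sup>*\<^sup>* (encode V) e" by blast
  then show "\<exists>W. ostep\<^sup>*\<^sup>* U W \<and> ostep\<^sup>*\<^sup>* V W" by (metis bwd encode_eqD)
qed

abbreviation conv :: "'f ty \<Rightarrow> 'f ty \<Rightarrow> bool" where
  "conv \<equiv> equivclp ostep"

lemma conv_iff: "conv T T' \<longleftrightarrow> (\<exists>U. ostep\<^sup>*\<^sup>* T U \<and> ostep\<^sup>*\<^sup>* T' U)"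
  unfolding semiconfluentp_equivclp[OF confluentp_imp_semiconfluentp[OF confluentp_ostep]]
    rtranclp_conversep by blast

lemma equivclp_map:
  assumes "\<And>x y. r x y \<Longrightarrow> equivclp s (f x) (f y)" and "equivclp r x y"
  shows "equivclp s (f x) (f y)"
  using assms(2)
  by induct (auto intro: equivclp_trans[OF _ assms(1)] equivclp_trans[OF _ equivclp_sym[OF assms(1)]])

lemma osteps_TImpD:
  "ostep\<^sup>*\<^sup>* (TImp A B) T \<Longrightarrow> \<exists>A' B'. T = TImp A' B' \<and> ostep\<^sup>*\<^sup>* A A' \<and> ostep\<^sup>*\<^sup>* B B'"
  by (induct rule: rtranclp_induct)
    (auto elim!: ostep_TImpE intro: rtranclp.rtrancl_into_rtrancl)

lemma osteps_TAllD: "ostep\<^sup>*\<^sup>* (TAll K A) T \<Longrightarrow> \<exists>A'. T = TAll K A' \<and> ostep\<^sup>*\<^sup>* A A'"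
  by (induct rule: rtranclp_induct)
    (auto elim!: ostep_TAllE intro: rtranclp.rtrancl_into_rtrancl)

lemma conv_TImpD: "conv (TImp A B) (TImp A' B') \<Longrightarrow> conv A A' \<and> conv B B'"
  unfolding conv_iff by (blast dest: osteps_TImpD)

lemma conv_TAllD: "conv (TAll K A) (TAll K' A') \<Longrightarrow> K = K' \<and> conv A A'"
  unfolding conv_iff by (blast dest: osteps_TAllD)

lemma not_conv_TImp_TAll: "\<not> conv (TImp A B) (TAll K C)"
  unfolding conv_iff by (blast dest: osteps_TAllD osteps_TImpD)

lemma not_conv_TAll_TImp: "\<not> conv (TAll K C) (TImp A B)"
  unfolding conv_iff by (blast dest: osteps_TAllD osteps_TImpD)

lemma onormal_osteps_eq: "onormal T \<Longrightarrow> ostep\<^sup>*\<^sup>* T U \<Longrightarrow> U = T"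
  by (metis converse_rtranclpE onormal_def)

lemma conv_onormal_osteps: "conv T N \<Longrightarrow> onormal N \<Longrightarrow> ostep\<^sup>*\<^sup>* T N"
  unfolding conv_iff by (auto dest: onormal_osteps_eq)

lemma ostep_tlift: "ostep T T' \<Longrightarrow> ostep (tlift c T) (tlift c T')"
  by (induct arbitrary: c rule: ostep.induct) (auto simp: tlift_tsubst_ge intro: ostep.intros)

lemma ostep_tsubst: "ostep T T' \<Longrightarrow> ostep (tsubst c S T) (tsubst c S T')"
  by (induct arbitrary: c S rule: ostep.induct) (auto simp: tsubst_tsubst intro: ostep.intros)

lemma conv_tlift: "conv T T' \<Longrightarrow> conv (tlift c T) (tlift c T')"
  by (rule equivclp_map[where f = "tlift c"]) (auto intro: ostep_tlift)

lemma conv_tsubst: "conv T T' \<Longrightarrow> conv (tsubst c S T) (tsubst c S T')"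
  by (rule equivclp_map[where f = "tsubst c S"]) (auto intro: ostep_tsubst)

lemma conv_TLam: "conv T T' \<Longrightarrow> conv (TLam T) (TLam T')"
  by (rule equivclp_map[where f = TLam]) (auto intro: ostep.intros)

lemma conv_TAll: "conv T T' \<Longrightarrow> conv (TAll K T) (TAll K T')"
  by (rule equivclp_map[where f = "TAll K"]) (auto intro: ostep.intros)

lemma conv_TApp: "conv T T' \<Longrightarrow> conv S S' \<Longrightarrow> conv (TApp T S) (TApp T' S')"
  by (rule equivclp_trans[of _ _ "TApp T' S"])
    (rule equivclp_map[where f = "\<lambda>T. TApp T S"] equivclp_map[where f = "TApp T'"];
      auto intro: ostep.intros)+

lemma conv_TImp: "conv T T' \<Longrightarrow> conv S S' \<Longrightarrow> conv (TImp T S) (TImp T' S')"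
  by (rule equivclp_trans[of _ _ "TImp T' S"])
    (rule equivclp_map[where f = "\<lambda>T. TImp T S"] equivclp_map[where f = "TImp T'"];
      auto intro: ostep.intros)+

lemma conv_tsubst_arg: "ostep S S' \<Longrightarrow> conv (tsubst c S T) (tsubst c S' T)"
  by (induct T arbitrary: c S S')
    (auto simp: ostep_tlift intro: conv_TLam conv_TAll conv_TApp conv_TImp)

subsection \<open>Kinds\<close>

inductive_cases kinded_TLamE: "kinded ar \<Delta> (TLam T) K"
inductive_cases kinded_TImpE: "kinded ar \<Delta> (TImp T S) K"
inductive_cases kinded_TAllE: "kinded ar \<Delta> (TAll K' T) K"
inductive_cases formula_TImpE: "formula ar \<Delta> (TImp T S)"
inductive_cases formula_TAllE: "formula ar \<Delta> (TAll K T)"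

text \<open>Generalizes \<open>case_nat\<close>, its instance for \<open>c = 0\<close>, so that
  inductions can pass below binders.\<close>

definition insert_kind :: "nat \<Rightarrow> kind \<Rightarrow> (nat \<Rightarrow> kind) \<Rightarrow> nat \<Rightarrow> kind" where
  "insert_kind c K \<Delta> i = (if i < c then \<Delta> i else if i = c then K else \<Delta> (i - 1))"

lemma insert_kind_0: "insert_kind 0 K \<Delta> = case_nat K \<Delta>"
  by (auto simp: insert_kind_def split: nat.split)

lemma case_nat_insert_kind: "case_nat K' (insert_kind c K \<Delta>) = insert_kind (Suc c) K (case_nat K' \<Delta>)"
  by (auto simp: insert_kind_def split: nat.split)

lemma tfree_tlift: "tfree i (tlift c T) \<longleftrightarrow> (if i < c then tfree i T else i \<noteq> c \<and> tfree (i - 1) T)"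
  by (induct T arbitrary: i c) (auto split: if_splits)

lemma tfree_tsubst:
  "c \<le> i \<Longrightarrow> tfree i (tsubst c S T) \<longleftrightarrow> tfree (Suc i) T \<or> tfree c T \<and> tfree i S"
  by (induct T arbitrary: i c S) (auto simp: tfree_tlift split: if_splits)

lemma tfree_tsubst_less:
  "i < c \<Longrightarrow> tfree i (tsubst c S T) \<longleftrightarrow> tfree i T \<or> tfree c T \<and> tfree i S"
  by (induct T arbitrary: i c S) (auto simp: tfree_tlift split: if_splits)

lemma kinded_tlift: "kinded ar \<Delta> T K' \<Longrightarrow> kinded ar (insert_kind c K \<Delta>) (tlift c T) K'"
proof (induct arbitrary: c rule: kinded.induct)
  case (2 \<Delta> x)
  have "\<Delta> x = insert_kind c K \<Delta> (if x < c then x else Suc x)"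
    by (auto simp: insert_kind_def)
  then show ?case by (auto intro: kinded.intros)
next
  case (3 \<Delta> T K')
  from 3(2)[of "Suc c"] 3(3) show ?case
    by (auto simp: case_nat_insert_kind tfree_tlift intro!: kinded.intros)
qed (auto intro: kinded.intros)

lemma kinded_case_nat_tlift: "kinded ar \<Delta> T K' \<Longrightarrow> kinded ar (case_nat K \<Delta>) (tlift 0 T) K'"
  using kinded_tlift[of ar \<Delta> T K' 0 K] by (simp add: insert_kind_0)

lemma kinded_tsubst:
  "kinded ar \<Delta>' T K' \<Longrightarrow> \<Delta>' = insert_kind c K \<Delta> \<Longrightarrow> kinded ar \<Delta> S K \<Longrightarrow> kinded ar \<Delta> (tsubst c S T) K'"
proof (induct arbitrary: c \<Delta> S rule: kinded.induct)
  case (2 \<Delta>' x)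
  then show ?case
    using kinded.intros(2)[of ar \<Delta> x] kinded.intros(2)[of ar \<Delta> "x - 1"]
    by (auto simp: insert_kind_def)
next
  case (3 \<Delta>' T K')
  from 3(2)[of "Suc c" "case_nat Star \<Delta>" "tlift 0 S"] 3(3-5) show ?case
    by (auto simp: case_nat_insert_kind tfree_tsubst_less kinded_case_nat_tlift intro!: kinded.intros)
qed (auto intro: kinded.intros)

lemma formula_tlift: "formula ar \<Delta> T \<Longrightarrow> formula ar (insert_kind c K \<Delta>) (tlift c T)"
proof (induct arbitrary: c rule: formula.induct)
  case (3 K' \<Delta> T)
  from 3(2)[of "Suc c"] show ?case
    by (auto simp: case_nat_insert_kind intro!: formula.intros(3))
qed (auto intro: formula.intros kinded_tlift)

lemma formula_tsubst:
  "formula ar \<Delta>' T \<Longrightarrow> \<Delta>' = insert_kind c K \<Delta> \<Longrightarrow> kinded ar \<Delta> S K \<Longrightarrow> formula ar \<Delta> (tsubst c S T)"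
proof (induct arbitrary: c \<Delta> S rule: formula.induct)
  case (3 K' \<Delta>' T)
  from 3(2)[of "Suc c" "case_nat K' \<Delta>" "tlift 0 S"] 3(3-) show ?case
    by (auto simp: case_nat_insert_kind kinded_case_nat_tlift intro!: formula.intros(3))
qed (auto intro: formula.intros kinded_tsubst)

text \<open>This is where the restriction of \<open>\<lambda>x. T\<close> to \<open>x \<in> FV(T)\<close> is needed: reduction of a well-kinded
  type does not erase variables.\<close>

lemma tfree_ostep: "kinded ar \<Delta> T K \<Longrightarrow> ostep T T' \<Longrightarrow> tfree i T \<Longrightarrow> tfree i T'"
proof (induct arbitrary: T' i rule: kinded.induct)
  case (4 \<Delta> T K S)
  from 4(5) show ?case
  proof (cases rule: ostep.cases)
    case (1 T0)
    with 4(1,6) show ?thesis by (auto simp: tfree_tsubst elim: kinded_TLamE)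
  qed (use 4 in auto)
qed (auto elim!: ostep_TFunE ostep_TVarE ostep_TLamE)

lemma kinded_ostep: "kinded ar \<Delta> T K \<Longrightarrow> ostep T T' \<Longrightarrow> kinded ar \<Delta> T' K"
proof (induct arbitrary: T' rule: kinded.induct)
  case (3 \<Delta> T K)
  from 3(4) show ?case
    using 3(1-3) by (auto elim!: ostep_TLamE intro!: kinded.intros(3) intro: tfree_ostep)
next
  case (4 \<Delta> T K S)
  from 4(5) show ?case
  proof (cases rule: ostep.cases)
    case (1 T0)
    with 4(1,3) show ?thesis
      by (auto elim!: kinded_TLamE intro: kinded_tsubst simp flip: insert_kind_0)
  qed (use 4 in \<open>auto intro: kinded.intros(4)\<close>)
qed (auto elim!: ostep_TFunE ostep_TVarE)

lemma formula_ostep: "formula ar \<Delta> T \<Longrightarrow> ostep T T' \<Longrightarrow> formula ar \<Delta> T'"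
  by (induct arbitrary: T' rule: formula.induct)
    (auto elim!: ostep_TImpE ostep_TAllE intro: formula.intros kinded_ostep)

lemma kinded_osteps: "ostep\<^sup>*\<^sup>* T T' \<Longrightarrow> kinded ar \<Delta> T K \<Longrightarrow> kinded ar \<Delta> T' K"
  by (induct rule: rtranclp_induct) (auto intro: kinded_ostep)

lemma formula_osteps: "ostep\<^sup>*\<^sup>* T T' \<Longrightarrow> formula ar \<Delta> T \<Longrightarrow> formula ar \<Delta> T'"
  by (induct rule: rtranclp_induct) (auto intro: formula_ostep)

text \<open>A common reduct would be an implication and yet have a term kind.\<close>

lemma not_conv_kinded_TImp: "kinded ar \<Delta> T K \<Longrightarrow> \<not> conv T (TImp A B)"
  unfolding conv_iff by (blast dest: osteps_TImpD kinded_osteps elim: kinded_TImpE)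

lemma not_conv_kinded_TAll: "kinded ar \<Delta> T K \<Longrightarrow> \<not> conv T (TAll K' A)"
  unfolding conv_iff by (blast dest: osteps_TAllD kinded_osteps elim: kinded_TAllE)

lemma formula_TImpD: "formula ar \<Delta> (TImp A B) \<Longrightarrow> formula ar \<Delta> A \<and> formula ar \<Delta> B"
  by (auto elim: formula_TImpE kinded_TImpE)

lemma formula_TAllD: "formula ar \<Delta> (TAll K A) \<Longrightarrow> formula ar (case_nat K \<Delta>) A"
  by (auto elim: formula_TAllE kinded_TAllE)

subsection \<open>Normal forms\<close>

lemma onormal_simps [simp]:
  "onormal (TFun f)"
  "onormal (TVar x)"
  "onormal (TLam T) \<longleftrightarrow> onormal T"
  "onormal (TAll K T) \<longleftrightarrow> onormal T"
  "onormal (TApp T S) \<longleftrightarrow> onormal T \<and> onormal S \<and> (\<nexists>T'. T = TLam T')"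
  "onormal (TImp T S) \<longleftrightarrow> onormal T \<and> onormal S"
  unfolding onormal_def
  by (blast elim: ostep_TFunE ostep_TVarE ostep_TLamE ostep_TAllE ostep_TAppE ostep_TImpE intro: ostep.intros)+

lemma tlift_eq_TLam: "tlift c T = TLam U \<Longrightarrow> \<exists>T'. T = TLam T'"
  by (cases T) auto

lemma tlift_not_TLam: "\<nexists>T'. T = TLam T' \<Longrightarrow> \<forall>U. tlift c T \<noteq> TLam U"
  by (auto dest: tlift_eq_TLam)

lemma onormal_tlift: "onormal T \<Longrightarrow> onormal (tlift c T)"
  by (induct T arbitrary: c) (auto dest: tlift_eq_TLam)

text \<open>Only an abstraction put in for a variable in function position could create a
  redex.\<close>

lemma onormal_tsubst:
  "onormal T \<Longrightarrow> onormal S \<Longrightarrow> (\<nexists>S'. S = TLam S') \<Longrightarrow> onormal (tsubst c S T)"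
proof (induct T arbitrary: c S)
  case (TApp T1 T2)
  then have "\<nexists>U. tsubst c S T1 = TLam U"
    by (cases T1) auto
  with TApp show ?case by auto
qed (auto simp: onormal_tlift tlift_not_TLam)

lemma kinded_Star_not_TLam: "kinded ar \<Delta> T Star \<Longrightarrow> \<nexists>T'. T = TLam T'"
  by (auto elim: kinded_TLamE)

text \<open>Arguments have kind \<open>Star\<close> and are never abstractions, so contracting a
  redex between normal forms creates no new one. Plain induction on the kinding therefore
  suffices.\<close>

lemma kinded_normalizing: "kinded ar \<Delta> T K \<Longrightarrow> \<exists>N. ostep\<^sup>*\<^sup>* T N \<and> onormal N"
proof (induct rule: kinded.induct)
  case (3 \<Delta> T K)
  then obtain N where N: "ostep\<^sup>*\<^sup>* T N" "onormal N" by blast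
  from N(1) have "ostep\<^sup>*\<^sup>* (TLam T) (TLam N)"
    by induct (auto intro: ostep.intros rtranclp.rtrancl_into_rtrancl)
  with N(2) show ?case by (intro exI[of _ "TLam N"]) auto
next
  case (4 \<Delta> T K S)
  then obtain N M where N: "ostep\<^sup>*\<^sup>* T N" "onormal N" and M: "ostep\<^sup>*\<^sup>* S M" "onormal M" by blast
  from N(1) have "ostep\<^sup>*\<^sup>* (TApp T S) (TApp N S)"
    by induct (auto intro: ostep.intros rtranclp.rtrancl_into_rtrancl)
  moreover from M(1) have "ostep\<^sup>*\<^sup>* (TApp N S) (TApp N M)"
    by induct (auto intro: ostep.intros rtranclp.rtrancl_into_rtrancl)
  ultimately have red: "ostep\<^sup>*\<^sup>* (TApp T S) (TApp N M)" by (rule rtranclp_trans)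
  show ?case
  proof (cases "\<exists>N'. N = TLam N'")
    case True
    then obtain N' where N': "N = TLam N'" by blast
    have "\<nexists>M'. M = TLam M'"
      using kinded_osteps[OF M(1) 4(3)] by (rule kinded_Star_not_TLam)
    with N N' M(2) have "onormal (tsubst 0 M N')"
      by (auto intro: onormal_tsubst)
    moreover have "ostep\<^sup>*\<^sup>* (TApp T S) (tsubst 0 M N')"
      using red unfolding N' by (rule rtranclp.rtrancl_into_rtrancl) (rule ostep.intros)
    ultimately show ?thesis by blast
  next
    case False
    with N M red show ?thesis by (intro exI[of _ "TApp N M"]) auto
  qed
qed (auto intro: exI[of _ "TFun _"] exI[of _ "TVar _"])

section \<open>Evidence\<close>

subsection \<open>Typing\<close>

text \<open>Closedness is phrased by its effect: lifting and substitution fix the type, which is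
  what keeps the rule \<open>Con\<close> stable under both.\<close>

definition valid_consts :: "('f \<Rightarrow> nat) \<Rightarrow> ('k \<rightharpoonup> 'f ty) \<Rightarrow> bool" where
  "valid_consts ar \<Sigma> \<longleftrightarrow> (\<forall>k T. \<Sigma> k = Some T \<longrightarrow>
     (\<forall>c. tlift c T = T) \<and> (\<forall>c S. tsubst c S T = T) \<and> (\<forall>\<Delta>. formula ar \<Delta> T))"

section \<open>Inversion of the typing rules up to conversion\<close>

lemma typing_EVarD:
  fixes \<Sigma> :: "'k \<rightharpoonup> 'f ty"
  shows "typing ar \<Sigma> \<Delta> \<Gamma> (EVar i) T \<Longrightarrow> i < length \<Gamma>"
  by (induct \<Delta> \<Gamma> "EVar i :: ('k, 'f) evid" T rule: typing.induct) auto

lemma typing_EConD: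
  fixes \<Sigma> :: "'k \<rightharpoonup> 'f ty"
  shows "typing ar \<Sigma> \<Delta> \<Gamma> (ECon k) T \<Longrightarrow> \<exists>T'. \<Sigma> k = Some T' \<and> conv T' T"
  by (induct \<Delta> \<Gamma> "ECon k :: ('k, 'f) evid" T rule: typing.induct)
    (blast intro: equivclp_refl, metis equivclp_trans)

lemma typing_EAppD:
  "typing ar \<Sigma> \<Delta> \<Gamma> (EApp e2 e1) T \<Longrightarrow>
   \<exists>A B. typing ar \<Sigma> \<Delta> \<Gamma> e2 (TImp A B) \<and> typing ar \<Sigma> \<Delta> \<Gamma> e1 A \<and> conv B T"
  by (induct \<Delta> \<Gamma> "EApp e2 e1" T rule: typing.induct) (blast intro: equivclp_refl, metis equivclp_trans)

lemma typing_ELamD: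
  "typing ar \<Sigma> \<Delta> \<Gamma> (ELam e) T \<Longrightarrow>
   \<exists>A B. formula ar \<Delta> A \<and> typing ar \<Sigma> \<Delta> (A # \<Gamma>) e B \<and> conv (TImp A B) T"
  by (induct \<Delta> \<Gamma> "ELam e" T rule: typing.induct) (blast intro: equivclp_refl, metis equivclp_trans)

lemma typing_ETAppD:
  "typing ar \<Sigma> \<Delta> \<Gamma> (ETApp e S) T \<Longrightarrow>
   \<exists>K A. typing ar \<Sigma> \<Delta> \<Gamma> e (TAll K A) \<and> kinded ar \<Delta> S K \<and> conv (tsubst 0 S A) T"
  by (induct \<Delta> \<Gamma> "ETApp e S" T rule: typing.induct) (blast intro: equivclp_refl, metis equivclp_trans)

lemma typing_ETLamD:
  "typing ar \<Sigma> \<Delta> \<Gamma> (ETLam e) T \<Longrightarrow>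
   \<exists>K A. typing ar \<Sigma> (case_nat K \<Delta>) (map (tlift 0) \<Gamma>) e A \<and> conv (TAll K A) T"
  by (induct \<Delta> \<Gamma> "ETLam e" T rule: typing.induct) (blast intro: equivclp_refl, metis equivclp_trans)

section \<open>Stability of typing under lifting and substitution\<close>

lemma typing_elift:
  "typing ar \<Sigma> \<Delta> \<Gamma> e T \<Longrightarrow> \<Gamma> = \<Gamma>1 @ \<Gamma>2 \<Longrightarrow>
   typing ar \<Sigma> \<Delta> (\<Gamma>1 @ A # \<Gamma>2) (elift (length \<Gamma>1) e) T"
proof (induct arbitrary: \<Gamma>1 \<Gamma>2 A rule: typing.induct)
  case (Var i \<Gamma> \<Delta>)
  have "typing ar \<Sigma> \<Delta> (\<Gamma>1 @ A # \<Gamma>2) (EVar j) ((\<Gamma>1 @ A # \<Gamma>2) ! j)"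
    if "j < length (\<Gamma>1 @ A # \<Gamma>2)" for j
    using that by (rule typing.Var)
  from this[of i] this[of "Suc i"] Var show ?case
    by (auto simp: nth_append)
next
  case (Lam \<Delta> T' \<Gamma> e T)
  from Lam(3)[of "T' # \<Gamma>1"] Lam(1,4) show ?case by (auto intro: typing.Lam)
next
  case (Mu \<Delta> T \<Gamma> e)
  from Mu(3)[of "T # \<Gamma>1"] Mu(1,4) show ?case by (auto intro: typing.Mu)
next
  case (Abs K \<Delta> \<Gamma> e T)
  from Abs(2)[of "map (tlift 0) \<Gamma>1" "map (tlift 0) \<Gamma>2" "tlift 0 A"] Abs(3) show ?case
    by (auto intro: typing.Abs)
next
  case (App \<Delta> \<Gamma> e2 T' T e1)
  from App(2)[OF App(5)] App(4)[OF App(5)] show ?case by (auto intro: typing.App)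
next
  case (Inst \<Delta> \<Gamma> e K T S)
  from Inst(2)[OF Inst(4)] Inst(3) show ?case by (auto intro: typing.Inst)
next
  case (Conv \<Delta> \<Gamma> e T T')
  from Conv(2)[OF Conv(5)] Conv(3,4) show ?case by (auto intro: typing.Conv)
qed (auto intro: typing.intros)

lemma typing_etlift:
  assumes "valid_consts ar \<Sigma>"
  shows "typing ar \<Sigma> \<Delta> \<Gamma> e T \<Longrightarrow>
    typing ar \<Sigma> (insert_kind c K \<Delta>) (map (tlift c) \<Gamma>) (etlift c e) (tlift c T)"
proof (induct arbitrary: c rule: typing.induct)
  case (Var i \<Gamma> \<Delta>)
  with typing.Var[of i "map (tlift c) \<Gamma>"] show ?case by auto
next
  case (Con k T \<Delta> \<Gamma>)
  with assms show ?case by (auto simp: valid_consts_def intro: typing.Con)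
next
  case (Inst \<Delta> \<Gamma> e K' T S)
  then show ?case
    by (auto simp: tlift_tsubst_ge intro: typing.Inst kinded_tlift)
next
  case (Abs K' \<Delta> \<Gamma> e T)
  from Abs(2)[of "Suc c"] show ?case
    by (auto simp: case_nat_insert_kind tlift_tlift intro!: typing.Abs cong: map_cong)
next
  case (Conv \<Delta> \<Gamma> e T T')
  then show ?case by (auto intro: typing.Conv conv_tlift formula_tlift)
qed (auto intro: typing.intros formula_tlift)

lemma typing_etsubst:
  assumes "valid_consts ar \<Sigma>"
  shows "typing ar \<Sigma> \<Delta>' \<Gamma> e T \<Longrightarrow> \<Delta>' = insert_kind c K \<Delta> \<Longrightarrow> kinded ar \<Delta> S K \<Longrightarrow>
    typing ar \<Sigma> \<Delta> (map (tsubst c S) \<Gamma>) (etsubst c S e) (tsubst c S T)"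
proof (induct arbitrary: c \<Delta> S rule: typing.induct)
  case (Var i \<Gamma> \<Delta>)
  with typing.Var[of i "map (tsubst c S) \<Gamma>"] show ?case by auto
next
  case (Con k T \<Delta> \<Gamma>)
  with assms show ?case by (auto simp: valid_consts_def intro: typing.Con)
next
  case (Inst \<Delta> \<Gamma> e K' T S)
  then show ?case
    by (auto simp: tsubst_tsubst intro: typing.Inst kinded_tsubst)
next
  case (Abs K' \<Delta>' \<Gamma> e T)
  from Abs(2)[of "Suc c" "case_nat K' \<Delta>" "tlift 0 S"] Abs(3,4) show ?case
    by (auto simp: case_nat_insert_kind tlift_tsubst_le kinded_case_nat_tlift intro!: typing.Abs
        cong: map_cong)
next
  case (Conv \<Delta> \<Gamma> e T T')
  then show ?case by (auto intro: typing.Conv conv_tsubst formula_tsubst)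
next
  case (App \<Delta> \<Gamma> e2 T' T e1)
  from App(2)[OF App(5,6)] App(4)[OF App(5,6)] show ?case by (auto intro: typing.App)
qed (auto intro: typing.intros formula_tsubst)

lemma typing_esubst:
  assumes "valid_consts ar \<Sigma>"
  shows "typing ar \<Sigma> \<Delta> \<Gamma> e T \<Longrightarrow> \<Gamma> = \<Gamma>1 @ A # \<Gamma>2 \<Longrightarrow> typing ar \<Sigma> \<Delta> (\<Gamma>1 @ \<Gamma>2) s A \<Longrightarrow>
    typing ar \<Sigma> \<Delta> (\<Gamma>1 @ \<Gamma>2) (esubst (length \<Gamma>1) s e) T"
proof (induct arbitrary: \<Gamma>1 \<Gamma>2 A s rule: typing.induct)
  case (Var i \<Gamma> \<Delta>)
  have "typing ar \<Sigma> \<Delta> (\<Gamma>1 @ \<Gamma>2) (EVar j) ((\<Gamma>1 @ \<Gamma>2) ! j)" if "j < length (\<Gamma>1 @ \<Gamma>2)" for j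
    using that by (rule typing.Var)
  note typed = this
  show ?case
  proof (cases "length \<Gamma>1 < i")
    case True
    then obtain j where "i = Suc j" by (cases i) auto
    with typed[of j] Var True show ?thesis by (auto simp: nth_append Suc_diff_le)
  next
    case False
    with typed[of i] Var show ?thesis by (auto simp: nth_append)
  qed
next
  case (Lam \<Delta> T' \<Gamma> e T)
  from Lam(3)[of "T' # \<Gamma>1" A \<Gamma>2 "elift 0 s"] Lam(1,4) typing_elift[OF Lam(5), of "[]" _ T']
  show ?case by (auto intro: typing.Lam)
next
  case (Mu \<Delta> T \<Gamma> e)
  from Mu(3)[of "T # \<Gamma>1" A \<Gamma>2 "elift 0 s"] Mu(1,4) typing_elift[OF Mu(5), of "[]" _ T]
  show ?case by (auto intro: typing.Mu)
next
  case (Abs K \<Delta> \<Gamma> e T)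
  from Abs(2)[of "map (tlift 0) \<Gamma>1" "tlift 0 A" "map (tlift 0) \<Gamma>2" "etlift 0 s"] Abs(3)
    typing_etlift[OF assms Abs(4), of 0 K] show ?case
    by (auto simp: insert_kind_0 intro: typing.Abs)
next
  case (App \<Delta> \<Gamma> e2 T' T e1)
  from App(2)[OF App(5,6)] App(4)[OF App(5,6)] show ?case by (auto intro: typing.App)
next
  case (Inst \<Delta> \<Gamma> e K T S)
  from Inst(2)[OF Inst(4,5)] Inst(3) show ?case by (auto intro: typing.Inst)
next
  case (Conv \<Delta> \<Gamma> e T T')
  from Conv(2)[OF Conv(5,6)] Conv(3,4) show ?case by (auto intro: typing.Conv)
qed (auto intro: typing.intros)

text \<open>Supplies the last premise of \<open>Conv\<close> wherever inversion has returned a type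
  only up to conversion.\<close>

lemma typing_formula:
  assumes "valid_consts ar \<Sigma>"
  shows "typing ar \<Sigma> \<Delta> \<Gamma> e T \<Longrightarrow> \<forall>A\<in>set \<Gamma>. formula ar \<Delta> A \<Longrightarrow> formula ar \<Delta> T"
proof (induct rule: typing.induct)
  case (Con k T \<Delta> \<Gamma>)
  with assms show ?case by (auto simp: valid_consts_def)
next
  case (App \<Delta> \<Gamma> e2 T' T e1)
  then show ?case by (auto dest: formula_TImpD)
next
  case (Inst \<Delta> \<Gamma> e K T T')
  then show ?case
    by (auto dest!: formula_TAllD intro: formula_tsubst simp flip: insert_kind_0)
next
  case (Abs K \<Delta> \<Gamma> e T)
  then show ?case
    by (auto simp: formula_tlift simp flip: insert_kind_0 intro!: formula.intros(3))
qed (auto intro: formula.intros)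

subsection \<open>Subject reduction\<close>

lemma typing_beta:
  assumes \<Sigma>: "valid_consts ar \<Sigma>" and \<Gamma>: "\<forall>A\<in>set \<Gamma>. formula ar \<Delta> A"
    and e: "typing ar \<Sigma> \<Delta> \<Gamma> (ELam e) (TImp A B)" and e': "typing ar \<Sigma> \<Delta> \<Gamma> e' A"
  shows "typing ar \<Sigma> \<Delta> \<Gamma> (esubst 0 e' e) B"
proof -
  from typing_ELamD[OF e] obtain A' B' where
    A': "formula ar \<Delta> A'" and body: "typing ar \<Sigma> \<Delta> (A' # \<Gamma>) e B'" and "conv (TImp A' B') (TImp A B)"
    by blast
  then have conv: "conv A' A" "conv B' B" by (auto dest: conv_TImpD)
  have "typing ar \<Sigma> \<Delta> \<Gamma> e' A'"
    using e' equivclp_sym[OF conv(1)] A' by (rule typing.Conv)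
  with typing_esubst[OF \<Sigma> body, of "[]"] have "typing ar \<Sigma> \<Delta> \<Gamma> (esubst 0 e' e) B'" by auto
  moreover have "formula ar \<Delta> B"
    using typing_formula[OF \<Sigma> e \<Gamma>] by (auto dest: formula_TImpD)
  ultimately show ?thesis using conv(2) by (blast intro: typing.Conv)
qed

lemma typing_tbeta:
  assumes \<Sigma>: "valid_consts ar \<Sigma>" and \<Gamma>: "\<forall>A\<in>set \<Gamma>. formula ar \<Delta> A"
    and e: "typing ar \<Sigma> \<Delta> \<Gamma> (ETLam e) (TAll K T)" and S: "kinded ar \<Delta> S K"
  shows "typing ar \<Sigma> \<Delta> \<Gamma> (etsubst 0 S e) (tsubst 0 S T)"
proof -
  from typing_ETLamD[OF e] obtain T' where
    body: "typing ar \<Sigma> (case_nat K \<Delta>) (map (tlift 0) \<Gamma>) e T'" and conv: "conv T' T"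
    by (auto dest: conv_TAllD)
  from typing_etsubst[OF \<Sigma> body insert_kind_0[symmetric] S]
  have "typing ar \<Sigma> \<Delta> \<Gamma> (etsubst 0 S e) (tsubst 0 S T')" by (simp add: comp_def)
  moreover have "formula ar \<Delta> (tsubst 0 S T)"
    using typing_formula[OF \<Sigma> typing.Inst[OF e S] \<Gamma>] .
  ultimately show ?thesis using conv_tsubst[OF conv] by (blast intro: typing.Conv)
qed

inductive_cases htauo_EVarE: "head_step (EVar i) e" "tauo_step (EVar i) e"
inductive_cases htauo_EConE: "head_step (ECon i) e" "tauo_step (ECon i) e"
inductive_cases htauo_ELamE: "head_step (ELam e) e'" "tauo_step (ELam e) e'"
inductive_cases htauo_EAppE: "head_step (EApp e a) e'" "tauo_step (EApp e a) e'"
inductive_cases htauo_EMuE: "head_step (EMu e) e'" "tauo_step (EMu e) e'"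
inductive_cases htauo_ETAppE: "head_step (ETApp e T) e'" "tauo_step (ETApp e T) e'"
inductive_cases htauo_ETLamE: "head_step (ETLam e) e'" "tauo_step (ETLam e) e'"

lemma subject_reduction:
  assumes \<Sigma>: "valid_consts ar \<Sigma>"
  shows "typing ar \<Sigma> \<Delta> \<Gamma> e T \<Longrightarrow> \<forall>A\<in>set \<Gamma>. formula ar \<Delta> A \<Longrightarrow> htauo_step e e' \<Longrightarrow>
    typing ar \<Sigma> \<Delta> \<Gamma> e' T"
proof (induct arbitrary: e' rule: typing.induct)
  case (App \<Delta> \<Gamma> e2 T' T e1)
  from App(6) show ?case unfolding htauo_step_def
    using App(1-5) typing_beta[OF \<Sigma> App(5) _ App(3)]
    by (auto elim!: htauo_EAppE intro: typing.App simp: htauo_step_def)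
next
  case (Lam \<Delta> T' \<Gamma> e T)
  then show ?case
    by (auto elim!: htauo_ELamE intro!: typing.Lam simp: htauo_step_def)
next
  case (Mu \<Delta> T \<Gamma> e)
  from typing_esubst[OF \<Sigma> Mu(2), of "[]" T \<Gamma>] typing.Mu[OF Mu(1,2)]
  have "typing ar \<Sigma> \<Delta> \<Gamma> (esubst 0 (EMu e) e) T" by auto
  with Mu show ?case
    by (auto elim!: htauo_EMuE intro!: typing.Mu simp: htauo_step_def)
next
  case (Inst \<Delta> \<Gamma> e K T S)
  \<comment> \<open>A step in the type argument changes the instance of the quantified type;
    \<open>Conv\<close> leads back to the old one.\<close>
  have "typing ar \<Sigma> \<Delta> \<Gamma> (ETApp e S') (tsubst 0 S T)" if "ostep S S'" for S'
    by (rule typing.Conv[OF typing.Inst[OF Inst(1) kinded_ostep[OF Inst(3) that]]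
          equivclp_sym[OF conv_tsubst_arg[OF that]]
          typing_formula[OF \<Sigma> typing.Inst[OF Inst(1,3)] Inst(4)]])
  with Inst(5) show ?case unfolding htauo_step_def
    using Inst(1-4) typing_tbeta[OF \<Sigma> Inst(4) _ Inst(3)]
    by (auto elim!: htauo_ETAppE intro: typing.Inst simp: htauo_step_def)
next
  case (Abs K \<Delta> \<Gamma> e T)
  then have "\<forall>A\<in>set (map (tlift 0) \<Gamma>). formula ar (case_nat K \<Delta>) A"
    by (auto simp: formula_tlift simp flip: insert_kind_0)
  with Abs show ?case
    by (auto elim!: htauo_ETLamE intro!: typing.Abs simp: htauo_step_def)
next
  case (Conv \<Delta> \<Gamma> e T T')
  then show ?case by (blast intro: typing.Conv)
qed (auto elim: htauo_EVarE htauo_EConE simp: htauo_step_def)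

lemma subject_reductions:
  assumes "valid_consts ar \<Sigma>" "typing ar \<Sigma> \<Delta> \<Gamma> e T" "\<forall>A\<in>set \<Gamma>. formula ar \<Delta> A"
    "htauo_step\<^sup>*\<^sup>* e e'"
  shows "typing ar \<Sigma> \<Delta> \<Gamma> e' T"
  using assms(4,2) by induct (auto intro: subject_reduction[OF assms(1) _ assms(3)])

subsection \<open>Erasure\<close>

lemma erase_elift [simp]: "erase (elift c e) = rlift c (erase e)"
  by (induct e arbitrary: c) auto

lemma erase_etlift [simp]: "erase (etlift c e) = erase e"
  by (induct e arbitrary: c) auto

lemma erase_esubst [simp]: "erase (esubst c s e) = rsubst c (erase s) (erase e)"
  by (induct e arbitrary: c s) auto

lemma erase_etsubst [simp]: "erase (etsubst c S e) = erase e"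
  by (induct e arbitrary: c S) auto

lemma erase_head_step: "head_step e e' \<Longrightarrow> bmu_step (erase e) (erase e') \<or> erase e = erase e'"
  by (induct rule: head_step.induct) (auto intro: bmu_step.intros)

lemma erase_tauo_step: "tauo_step e e' \<Longrightarrow> erase e' = erase e"
  by (induct rule: tauo_step.induct) auto

lemma erase_htauo_steps: "htauo_step\<^sup>*\<^sup>* e e' \<Longrightarrow> bmu_step\<^sup>*\<^sup>* (erase e) (erase e')"
  by (induct rule: rtranclp_induct)
    (auto simp: htauo_step_def dest!: erase_head_step erase_tauo_step intro: rtranclp.rtrancl_into_rtrancl)

lemma HHN_htauo_steps: "htauo_step\<^sup>*\<^sup>* e e' \<Longrightarrow> e \<in> HHN \<Longrightarrow> e' \<in> HHN"
  by (auto simp: HHN_def intro: HN_forward erase_htauo_steps)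

subsection \<open>Lifting weak head reductions of erasures\<close>

lemma htauo_steps_App: "htauo_step\<^sup>*\<^sup>* e e' \<Longrightarrow> htauo_step\<^sup>*\<^sup>* (EApp e a) (EApp e' a)"
  by (induct rule: rtranclp_induct)
    (auto simp: htauo_step_def intro: rtranclp.rtrancl_into_rtrancl head_step.intros tauo_step.intros)

lemma htauo_steps_TApp: "htauo_step\<^sup>*\<^sup>* e e' \<Longrightarrow> htauo_step\<^sup>*\<^sup>* (ETApp e T) (ETApp e' T)"
  by (induct rule: rtranclp_induct)
    (auto simp: htauo_step_def intro: rtranclp.rtrancl_into_rtrancl head_step.intros tauo_step.intros)

lemma htauo_steps_TLam: "htauo_step\<^sup>*\<^sup>* e e' \<Longrightarrow> htauo_step\<^sup>*\<^sup>* (ETLam e) (ETLam e')"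
  by (induct rule: rtranclp_induct)
    (auto simp: htauo_step_def intro: rtranclp.rtrancl_into_rtrancl head_step.intros tauo_step.intros)

lemma htauo_steps_TApp_arg: "ostep\<^sup>*\<^sup>* T T' \<Longrightarrow> htauo_step\<^sup>*\<^sup>* (ETApp e T) (ETApp e T')"
  by (induct rule: rtranclp_induct)
    (auto simp: htauo_step_def intro: rtranclp.rtrancl_into_rtrancl tauo_step.intros)

section \<open>Weak head normal forms behind type redexes\<close>

fun neutral :: "('k, 'f) evid \<Rightarrow> bool" where
  "neutral (EVar i) = True"
| "neutral (ECon k) = True"
| "neutral (EApp e a) = neutral e"
| "neutral (ETApp e T) = neutral e"
| "neutral _ = False"

text \<open>Types have no weight, which makes the measure invariant under
  \<open>etsubst\<close>.\<close>

primrec esize :: "('k, 'f) evid \<Rightarrow> nat" where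
  "esize (EVar i) = 1"
| "esize (ECon k) = 1"
| "esize (ELam e) = Suc (esize e)"
| "esize (EApp e a) = Suc (esize e + esize a)"
| "esize (EMu e) = Suc (esize e)"
| "esize (ETApp e T) = Suc (esize e)"
| "esize (ETLam e) = Suc (esize e)"

lemma esize_etsubst [simp]: "esize (etsubst c S e) = esize e"
  by (induct e arbitrary: c S) auto

text \<open>Well-typed evidence whose erasure is in weak head normal form can fail to be so itself only because
  of type redexes, and removing these makes the evidence smaller.\<close>

lemma expose_whnf:
  assumes \<Sigma>: "valid_consts ar \<Sigma>" and "typing ar \<Sigma> \<Delta> \<Gamma> e T" and \<Gamma>: "\<forall>A\<in>set \<Gamma>. formula ar \<Delta> A"
    and "\<nexists>r. wh_step (erase e) r"
  shows "\<exists>e'. htauo_step\<^sup>*\<^sup>* e e' \<and> erase e' = erase e \<and> esize e' \<le> esize e \<and>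
    ((\<exists>b. e' = ELam b) \<or> (\<exists>b. e' = ETLam b) \<or> neutral e')"
  using assms(2,4)
proof (induct "esize e" arbitrary: e T rule: less_induct)
  case less
  show ?case
  proof (cases e)
    case (EMu b)
    with less.prems(2) show ?thesis by (auto intro: wh_step.intros)
  next
    case (EApp e1 e2)
    from less.prems(1) EApp obtain A B where
      e1: "typing ar \<Sigma> \<Delta> \<Gamma> e1 (TImp A B)"
      by (auto dest: typing_EAppD)
    have "\<nexists>r. wh_step (erase e1) r"
      using less.prems(2) EApp by (auto intro: wh_step.intros)
    with less.hyps[OF _ e1] EApp obtain e' where e':
      "htauo_step\<^sup>*\<^sup>* e1 e'" "erase e' = erase e1" "esize e' \<le> esize e1"
      "(\<exists>b. e' = ELam b) \<or> (\<exists>b. e' = ETLam b) \<or> neutral e'"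
      by auto
    have "typing ar \<Sigma> \<Delta> \<Gamma> e' (TImp A B)"
      by (rule subject_reductions[OF \<Sigma> e1 \<Gamma> e'(1)])
    \<comment> \<open>Typing does the work here: a type abstraction has a quantified type, which
      does not convert to the implication required in function position.\<close>
    then have "\<nexists>b. e' = ETLam b"
      by (auto dest!: typing_ETLamD simp: not_conv_TAll_TImp)
    moreover have "\<nexists>b. e' = ELam b"
      by (metis EApp e'(2) erase.simps(3,4) less.prems(2) wh_beta)
    ultimately have "neutral e'" using e'(4) by blast
    with EApp e' show ?thesis by (intro exI[of _ "EApp e' e2"]) (auto intro: htauo_steps_App)
  next
    case (ETApp e1 S)
    from less.prems(1) ETApp obtain K A where
      e1: "typing ar \<Sigma> \<Delta> \<Gamma> e1 (TAll K A)"
      by (auto dest: typing_ETAppD)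
    have "\<nexists>r. wh_step (erase e1) r"
      using less.prems(2) ETApp by auto
    with less.hyps[OF _ e1] ETApp obtain e' where e':
      "htauo_step\<^sup>*\<^sup>* e1 e'" "erase e' = erase e1" "esize e' \<le> esize e1"
      "(\<exists>b. e' = ELam b) \<or> (\<exists>b. e' = ETLam b) \<or> neutral e'"
      by auto
    have "typing ar \<Sigma> \<Delta> \<Gamma> e' (TAll K A)"
      by (rule subject_reductions[OF \<Sigma> e1 \<Gamma> e'(1)])
    then have "\<nexists>b. e' = ELam b"
      by (auto dest!: typing_ELamD simp: not_conv_TImp_TAll)
    with e'(4) consider b where "e' = ETLam b" | "neutral e'" by blast
    then show ?thesis
    proof cases
      case 1
      have "htauo_step (ETApp (ETLam b) S) (etsubst 0 S b)"
        by (auto simp: htauo_step_def intro: tauo_step.intros)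
      with htauo_steps_TApp[OF e'(1), of S] ETApp 1
      have red: "htauo_step\<^sup>*\<^sup>* e (etsubst 0 S b)"
        by (auto intro: rtranclp.rtrancl_into_rtrancl)
      have er: "erase (etsubst 0 S b) = erase e"
        using e'(2) 1 ETApp by simp
      have sz: "esize (etsubst 0 S b) < esize e" using e'(3) 1 ETApp by simp
      from less.hyps[OF sz subject_reductions[OF \<Sigma> less.prems(1) \<Gamma> red]] less.prems(2) er
      obtain e'' where "htauo_step\<^sup>*\<^sup>* (etsubst 0 S b) e''" "erase e'' = erase e"
        "esize e'' \<le> esize (etsubst 0 S b)"
        "(\<exists>b. e'' = ELam b) \<or> (\<exists>b. e'' = ETLam b) \<or> neutral e''"
        by auto
      with red sz show ?thesis by (intro exI[of _ e'']) (auto intro: rtranclp_trans)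
    next
      case 2
      with ETApp e' show ?thesis by (intro exI[of _ "ETApp e' S"]) (auto intro: htauo_steps_TApp)
    qed
  qed auto
qed

text \<open>The abstraction of an erased beta redex may be hidden in the evidence by type redexes;
  \<open>expose_whnf\<close> clears them first, hence several steps for one.\<close>

lemma lift_wh_step:
  assumes \<Sigma>: "valid_consts ar \<Sigma>"
  shows "typing ar \<Sigma> \<Delta> \<Gamma> e T \<Longrightarrow> \<forall>A\<in>set \<Gamma>. formula ar \<Delta> A \<Longrightarrow> wh_step (erase e) r \<Longrightarrow>
    \<exists>e'. htauo_step\<^sup>*\<^sup>* e e' \<and> erase e' = r"
proof (induct arbitrary: r rule: typing.induct)
  case (App \<Delta> \<Gamma> e2 T' T e1)
  from App(6) show ?case
  proof (cases rule: wh_step.cases)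
    case (wh_beta a b)
    then have a: "erase e2 = RLam a" and b: "b = erase e1" by auto
    then have "\<nexists>r. wh_step (erase e2) r" by (auto elim: wh_step.cases)
    from expose_whnf[OF \<Sigma> App(1,5) this] obtain e' where e':
      "htauo_step\<^sup>*\<^sup>* e2 e'" "erase e' = erase e2"
      "(\<exists>b. e' = ELam b) \<or> (\<exists>b. e' = ETLam b) \<or> neutral e'" by auto
    have "\<nexists>b. e' = ETLam b"
      using subject_reductions[OF \<Sigma> App(1,5) e'(1)]
      by (auto dest!: typing_ETLamD simp: not_conv_TAll_TImp)
    moreover have "\<not> neutral e'"
    proof
      have "neutral d \<Longrightarrow> erase d \<noteq> RLam c" for d :: "('b, 'a) evid" and c
        by (induct d) auto
      moreover assume "neutral e'"
      ultimately show False using e'(2) a by auto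
    qed
    ultimately obtain c where c: "e' = ELam c" using e'(3) by blast
    have "htauo_step (EApp (ELam c) e1) (esubst 0 e1 c)"
      by (auto simp: htauo_step_def intro: head_step.intros)
    with htauo_steps_App[OF e'(1), of e1] c have "htauo_step\<^sup>*\<^sup>* (EApp e2 e1) (esubst 0 e1 c)"
      by (auto intro: rtranclp.rtrancl_into_rtrancl)
    moreover have "erase (esubst 0 e1 c) = r"
      using wh_beta a b e'(2) c by auto
    ultimately show ?thesis by blast
  next
    case (wh_app a a' b)
    with App(2)[OF App(5)] obtain e' where "htauo_step\<^sup>*\<^sup>* e2 e'" "erase e' = a'" by auto
    with wh_app show ?thesis by (intro exI[of _ "EApp e' e1"]) (auto intro: htauo_steps_App)
  qed auto
next
  case (Mu \<Delta> T \<Gamma> e)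
  have "htauo_step (EMu e) (esubst 0 (EMu e) e)"
    by (auto simp: htauo_step_def intro: head_step.intros)
  with Mu(5) show ?case by (intro exI[of _ "esubst 0 (EMu e) e"]) (auto elim: wh_step.cases)
next
  case (Inst \<Delta> \<Gamma> e K T S)
  then obtain e' where "htauo_step\<^sup>*\<^sup>* e e'" "erase e' = r" by auto
  then show ?case by (intro exI[of _ "ETApp e' S"]) (auto intro: htauo_steps_TApp)
next
  case (Abs K \<Delta> \<Gamma> e T)
  then have "\<forall>A\<in>set (map (tlift 0) \<Gamma>). formula ar (case_nat K \<Delta>) A"
    by (auto simp: formula_tlift simp flip: insert_kind_0)
  with Abs obtain e' where "htauo_step\<^sup>*\<^sup>* e e'" "erase e' = r" by auto
  then show ?case by (intro exI[of _ "ETLam e'"]) (auto intro: htauo_steps_TLam)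
qed (auto elim: wh_step.cases)

lemma lift_wh_steps:
  assumes \<Sigma>: "valid_consts ar \<Sigma>" and e: "typing ar \<Sigma> \<Delta> \<Gamma> e T" and \<Gamma>: "\<forall>A\<in>set \<Gamma>. formula ar \<Delta> A"
    and "wh_step\<^sup>*\<^sup>* (erase e) r"
  shows "\<exists>e'. htauo_step\<^sup>*\<^sup>* e e' \<and> erase e' = r"
  using assms(4)
proof (induct rule: rtranclp_induct)
  case (step r r')
  then obtain e' where e': "htauo_step\<^sup>*\<^sup>* e e'" "erase e' = r" by blast
  with lift_wh_step[OF \<Sigma> subject_reductions[OF \<Sigma> e \<Gamma> e'(1)] \<Gamma>] step(2) obtain e'' where
    "htauo_step\<^sup>*\<^sup>* e' e''" "erase e'' = r'" by blast
  with e'(1) show ?case by (blast intro: rtranclp_trans)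
qed auto

section \<open>First-order terms as types\<close>

lemma foldl_TApp_TFun_neq [simp]:
  "foldl TApp (TFun f) Ts \<noteq> TVar x"
  "foldl TApp (TFun f) Ts \<noteq> TLam T"
  "foldl TApp (TFun f) Ts \<noteq> TAll K T"
  "foldl TApp (TFun f) Ts \<noteq> TImp T S"
  by (cases Ts rule: rev_cases; simp)+

lemma foldl_TApp_TFun_eq_TFun [simp]:
  "foldl TApp (TFun f) Ts = TFun g \<longleftrightarrow> f = g \<and> Ts = []"
  "TFun g = foldl TApp (TFun f) Ts \<longleftrightarrow> g = f \<and> Ts = []"
  by (cases Ts rule: rev_cases; auto)+

lemma foldl_TApp_TFun_eq_TApp:
  "foldl TApp (TFun f) Ts = TApp T S \<longleftrightarrow> (\<exists>Ts'. Ts = Ts' @ [S] \<and> T = foldl TApp (TFun f) Ts')"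
  by (cases Ts rule: rev_cases) auto

lemma foldl_TApp_TFun_inject [simp]:
  "foldl TApp (TFun f) Ts = foldl TApp (TFun g) Ss \<longleftrightarrow> f = g \<and> Ts = Ss"
proof (induct Ts arbitrary: Ss rule: rev_induct)
  case (snoc T Ts)
  then show ?case by (cases Ss rule: rev_cases) auto
qed auto

lemma tsubst_foldl_TApp: "tsubst c S (foldl TApp T Ts) = foldl TApp (tsubst c S T) (map (tsubst c S) Ts)"
  by (induct Ts arbitrary: T) auto

lemma tfree_foldl_TApp: "tfree i (foldl TApp T Ts) \<longleftrightarrow> tfree i T \<or> (\<exists>S\<in>set Ts. tfree i S)"
  by (induct Ts arbitrary: T) auto

lemma onormal_foldl_TApp_TFun: "onormal (foldl TApp (TFun f) Ts) \<longleftrightarrow> (\<forall>T\<in>set Ts. onormal T)"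
  by (induct Ts rule: rev_induct) auto

lemma kinded_foldl_TApp:
  "kinded ar \<Delta> T ((Arr ^^ length Ts) K) \<Longrightarrow> \<forall>S\<in>set Ts. kinded ar \<Delta> S Star \<Longrightarrow>
   kinded ar \<Delta> (foldl TApp T Ts) K"
  by (induct Ts arbitrary: T) (auto intro: kinded.intros)

subsection \<open>Instances of first-order terms by types\<close>

text \<open>Variables may be replaced by arbitrary types: that the type arguments of a trace are
  first-order terms is known only after the comparison with \<open>t\<close>.\<close>

fun ty_inst :: "(nat \<Rightarrow> 'f ty) \<Rightarrow> 'f trm \<Rightarrow> 'f ty" where
  "ty_inst \<theta> (Var x) = \<theta> x"
| "ty_inst \<theta> (Fun f ts) = foldl TApp (TFun f) (map (ty_inst \<theta>) ts)"

lemma ty_of_subst: "ty_of (subst \<sigma> t) = ty_inst (ty_of \<circ> \<sigma>) t"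
  by (induct t) (auto simp: comp_def cong: map_cong)

lemma ty_of_eq_ty_inst: "ty_of t = ty_inst TVar t"
  by (induct t) (auto cong: map_cong)

lemma tsubst_ty_inst: "tsubst c S (ty_inst \<theta> t) = ty_inst (tsubst c S \<circ> \<theta>) t"
  by (induct t) (auto simp: tsubst_foldl_TApp cong: map_cong)

lemma tfree_ty_inst: "tfree i (ty_inst \<theta> t) \<longleftrightarrow> (\<exists>x\<in>set (occs t). tfree i (\<theta> x))"
  by (induct t) (auto simp: tfree_foldl_TApp)

lemma ty_inst_cong: "(\<And>x. x \<in> set (occs t) \<Longrightarrow> \<theta> x = \<theta>' x) \<Longrightarrow> ty_inst \<theta> t = ty_inst \<theta>' t"
  by (induct t) (auto cong: map_cong)

lemma onormal_ty_inst: "\<forall>x\<in>set (occs t). onormal (\<theta> x) \<Longrightarrow> onormal (ty_inst \<theta> t)"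
  by (induct t) (auto simp: onormal_foldl_TApp_TFun)

lemma kinded_ty_inst:
  "wf_trm ar t \<Longrightarrow> \<forall>x\<in>set (occs t). kinded ar \<Delta> (\<theta> x) Star \<Longrightarrow> kinded ar \<Delta> (ty_inst \<theta> t) Star"
proof (induct t)
  case (Fun f ts)
  then show ?case
    using kinded.intros(1)[of ar \<Delta> f] by (auto intro!: kinded_foldl_TApp)
qed auto

lemma onormal_ty_of: "onormal (ty_of t)"
  by (auto simp: ty_of_eq_ty_inst intro: onormal_ty_inst)

lemma formula_ty_of_kinded: "formula ar \<Delta> (ty_of t) \<Longrightarrow> kinded ar \<Delta> (ty_of t) Star"
  by (erule formula.cases; cases t) auto

lemma ty_of_eq_TVar [simp]: "ty_of t = TVar x \<longleftrightarrow> t = Var x" "TVar x = ty_of t \<longleftrightarrow> t = Var x"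
  using foldl_TApp_TFun_neq(1) by (cases t; auto dest: sym)+

lemma ty_of_inject: "ty_of t = ty_of t' \<longleftrightarrow> t = t'"
proof (induct t arbitrary: t')
  case (Fun f ts)
  have "map ty_of ts = map ty_of ts' \<Longrightarrow> ts = ts'" for ts'
    using Fun.hyps by (induct ts ts' rule: list_induct2') auto
  then show ?case by (cases t') auto
qed auto

text \<open>The symbols of \<open>l\<close> match those of \<open>s\<close> all the way down to the
  occurrence of \<open>x\<close>, where a subterm of \<open>s\<close> is found.\<close>

lemma ty_inst_eq_ty_ofD:
  "ty_inst \<theta> l = ty_of s \<Longrightarrow> x \<in> set (occs l) \<Longrightarrow> \<exists>u. \<theta> x = ty_of u"
proof (induct l arbitrary: s)
  case (Fun f ls)
  then show ?case by (cases s) (auto simp: map_eq_conv in_set_conv_nth list_eq_iff_nth_eq, metis nth_mem)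
qed auto

subsection \<open>Contexts\<close>

lemma fills_replicate:
  "fills Cs (replicate (sum_list (map holes Cs)) s) = map (\<lambda>C. fill C (replicate (holes C) s)) Cs"
  by (induct Cs) (auto simp: replicate_add)

lemma tsubst_ctxt_body:
  "tsubst 0 (ty_of s) (ctxt_body C) = ty_of (fill C (replicate (holes C) s))"
  by (induct C) (auto simp: tsubst_foldl_TApp fills_replicate)

lemma ctxt_body_inject: "ctxt_body C = ctxt_body D \<longleftrightarrow> C = D"
proof (induct C arbitrary: D)
  case Hole
  then show ?case by (cases D) (auto dest: sym)
next
  case (CVar x)
  then show ?case by (cases D) (auto dest: sym)
next
  case (CFun f Cs)
  have "map ctxt_body Cs = map ctxt_body Ds \<Longrightarrow> Cs = Ds" for Ds
    using CFun.hyps by (induct Cs Ds rule: list_induct2') auto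
  then show ?case by (cases D) auto
qed

lemma denotes_ctxt_unique:
  assumes "denotes_ctxt P C" and "denotes_ctxt P D"
  shows "C = D"
proof -
  \<comment> \<open>The eta-expanded reading of an abstraction would be a redex, and no
    \<open>ctxt_body\<close> is one; so the two cases of \<open>denotes_ctxt\<close> exclude each
    other.\<close>
  have "TApp (TLam T) S \<noteq> ctxt_body E" for T S :: "'a ty" and E
    by (cases E) (auto simp: foldl_TApp_TFun_eq_TApp foldl_TApp_TFun_neq(2)[symmetric] dest: sym[of "TApp _ _"])
  with assms show ?thesis by (auto simp: denotes_ctxt_def ctxt_body_inject)
qed

text \<open>The kinding excludes that the substituted \<open>S\<close> is a partial application that becomes a first-order
  term only together with arguments contributed by \<open>N\<close>; the second part covers the proper prefixes of
  a term \<open>F t\<^sub>1 \<dots> t\<^sub>n\<close>.\<close>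

lemma tsubst_eq_ty_ofD:
  assumes "kinded ar \<Delta>' N K" and "\<Delta>' = case_nat Star \<Delta>"
  shows "(\<forall>t. tsubst 0 S N = ty_of t \<longrightarrow>
      (\<exists>C. N = ctxt_body C \<and> (tfree 0 N \<longrightarrow> (\<exists>s. S = ty_of s)))) \<and>
    (\<forall>f ts. K \<noteq> Star \<longrightarrow> tsubst 0 S N = foldl TApp (TFun f) (map ty_of ts) \<longrightarrow>
      (\<exists>Cs. N = foldl TApp (TFun f) (map ctxt_body Cs) \<and> (tfree 0 N \<longrightarrow> (\<exists>s. S = ty_of s))))"
  using assms
proof (induct rule: kinded.induct)
  case (1 \<Delta>' f)
  then show ?case
    by (auto intro: exI[of _ "CFun f []"] exI[of _ "[]"] dest: sym[of "TFun _"])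
next
  case (2 \<Delta>' x)
  show ?case
  proof (cases x)
    \<comment> \<open>Index 0 has kind \<open>Star\<close>, so only the first part of the claim is
      at stake, and there \<open>S\<close> is the term itself.\<close>
    case 0
    with 2 show ?thesis by (auto intro: exI[of _ Hole])
  next
    case (Suc y)
    with 2 foldl_TApp_TFun_neq(1) show ?thesis
      by (auto intro!: exI[of _ "CVar y"] dest: sym[of "TVar _"])
  qed
next
  case (3 \<Delta>' T K)
  have "tsubst 0 S (TLam T) \<noteq> ty_of t" for t
    by (cases t) (use foldl_TApp_TFun_neq(2) in \<open>auto dest: sym\<close>)
  moreover have "tsubst 0 S (TLam T) \<noteq> foldl TApp (TFun f) Ts" for f Ts
    using foldl_TApp_TFun_neq(2) by (auto dest: sym)
  ultimately show ?case by blast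
next
  case (4 \<Delta>' T K U)
  have *: "\<exists>Cs. TApp T U = foldl TApp (TFun f) (map ctxt_body Cs) \<and> (tfree 0 (TApp T U) \<longrightarrow> (\<exists>s. S = ty_of s))"
    if eq: "tsubst 0 S (TApp T U) = foldl TApp (TFun f) (map ty_of ts)" for f ts
  proof -
    from eq obtain ts' t where
      "tsubst 0 S T = foldl TApp (TFun f) (map ty_of ts')" "tsubst 0 S U = ty_of t"
      by (cases ts rule: rev_cases) auto
    \<comment> \<open>\<open>T\<close> has kind \<open>Arr K\<close> and falls under the second part
      of the hypothesis, \<open>U\<close> under the first.\<close>
    with 4 obtain Cs C where
      "T = foldl TApp (TFun f) (map ctxt_body Cs)" "tfree 0 T \<longrightarrow> (\<exists>s. S = ty_of s)"
      "U = ctxt_body C" "tfree 0 U \<longrightarrow> (\<exists>s. S = ty_of s)"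
      by blast
    then show ?thesis by (intro exI[of _ "Cs @ [C]"]) auto
  qed
  moreover have "\<exists>C. TApp T U = ctxt_body C \<and> (tfree 0 (TApp T U) \<longrightarrow> (\<exists>s. S = ty_of s))"
    if eq: "tsubst 0 S (TApp T U) = ty_of t" for t
  proof -
    from eq obtain f ts where "tsubst 0 S (TApp T U) = foldl TApp (TFun f) (map ty_of ts)"
      by (cases t) auto
    from *[OF this] show ?thesis by (metis ctxt_body.simps(3))
  qed
  ultimately show ?case by blast
qed

section \<open>Leibniz representations\<close>

text \<open>The expression used in \<open>leibniz\<close>; thus \<open>ts ! var_pos l x\<close> is
  the type that instantiates \<open>x\<close>.\<close>

definition var_pos :: "'f trm \<Rightarrow> nat \<Rightarrow> nat" where
  "var_pos l x = length (takeWhile (\<lambda>y. y \<noteq> x) (fv_list l))"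

lemma set_fv_list [simp]: "set (fv_list t) = set (occs t)"
  by (simp add: fv_list_def)

lemma distinct_fv_list [simp]: "distinct (fv_list t)"
  by (simp add: fv_list_def)

lemma var_pos_less:
  assumes "x \<in> set (occs l)"
  shows "var_pos l x < length (fv_list l)"
proof -
  have "dropWhile (\<lambda>y. y \<noteq> x) (fv_list l) \<noteq> []"
    using assms by (auto simp: dropWhile_eq_Nil_conv)
  moreover have "length (fv_list l) = var_pos l x + length (dropWhile (\<lambda>y. y \<noteq> x) (fv_list l))"
    unfolding var_pos_def by (metis length_append takeWhile_dropWhile_id)
  ultimately show ?thesis by simp
qed

lemma nth_var_pos: "x \<in> set (occs l) \<Longrightarrow> fv_list l ! var_pos l x = x"
  using nth_length_takeWhile[of "\<lambda>y. y \<noteq> x" "fv_list l"] var_pos_less[of x l]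
  by (simp add: var_pos_def)

lemma var_pos_nth: "i < length (fv_list l) \<Longrightarrow> var_pos l (fv_list l ! i) = i"
  by (metis distinct_fv_list nth_eq_iff_index_eq nth_mem nth_var_pos set_fv_list var_pos_less)

abbreviation leibniz_body :: "nat \<Rightarrow> (nat \<Rightarrow> 'f ty) \<Rightarrow> 'f rule \<Rightarrow> 'f ty" where
  "leibniz_body n \<theta> \<rho> \<equiv> TImp (TApp (TVar n) (ty_inst \<theta> (snd \<rho>))) (TApp (TVar n) (ty_inst \<theta> (fst \<rho>)))"

text \<open>Listing the kinds opens the quantifier prefix to induction.\<close>

lemma leibniz_eq:
  "leibniz (l, r) = foldr TAll (Arr Star # replicate (length (fv_list l)) Star)
     (leibniz_body (length (fv_list l)) (\<lambda>x. TVar (length (fv_list l) - 1 - var_pos l x)) (l, r))"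
proof -
  have "(TAll Star ^^ n) T = foldr TAll (replicate n Star) T" for n and T :: "'a ty"
    by (induct n) auto
  then show ?thesis
    by (simp add: leibniz_def Let_def ty_of_subst var_pos_def comp_def)
qed

section \<open>Closedness and well-formedness of Leibniz types\<close>

lemma not_tfree_tlift: "\<forall>i\<ge>c. \<not> tfree i T \<Longrightarrow> tlift c T = T"
proof (induct T arbitrary: c)
  case (TVar x)
  then show ?case by (auto simp: not_less[symmetric])
next
  case (TLam T)
  from TLam.prems have "\<forall>i\<ge>Suc c. \<not> tfree i T" by (metis Suc_le_D Suc_le_mono tfree.simps(3))
  with TLam.hyps show ?case by simp
next
  case (TAll K T)
  from TAll.prems have "\<forall>i\<ge>Suc c. \<not> tfree i T" by (metis Suc_le_D Suc_le_mono tfree.simps(4))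
  with TAll.hyps show ?case by simp
qed auto

lemma not_tfree_tsubst: "\<forall>i\<ge>c. \<not> tfree i T \<Longrightarrow> tsubst c S T = T"
  by (metis not_tfree_tlift tsubst_tlift)

lemma tfree_foldr_TAll: "tfree i (foldr TAll Ks T) \<longleftrightarrow> tfree (i + length Ks) T"
  by (induct Ks arbitrary: i) auto

lemma formula_foldr_TAll:
  "formula ar (foldl (\<lambda>\<Delta> K. case_nat K \<Delta>) \<Delta> Ks) T \<Longrightarrow> formula ar \<Delta> (foldr TAll Ks T)"
  by (induct Ks arbitrary: \<Delta>) (auto intro: formula.intros(3))

text \<open>The innermost binder comes last in \<open>Ks\<close> and has index 0, hence the
  reversal.\<close>

lemma foldl_case_nat:
  "i < length Ks \<Longrightarrow> foldl (\<lambda>\<Delta> K. case_nat K \<Delta>) \<Delta> Ks i = Ks ! (length Ks - 1 - i)"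
  by (induct Ks arbitrary: i rule: rev_induct) (auto simp: nth_append split: nat.split)

lemma valid_consts_leibniz_env:
  assumes "\<forall>\<rho>\<in>ran R. wf_rule ar \<rho>"
  shows "valid_consts ar (leibniz_env R)"
  unfolding valid_consts_def
proof (intro allI impI)
  fix k T
  assume "leibniz_env R k = Some T"
  then obtain l r where R: "R k = Some (l, r)" and T: "T = leibniz (l, r)"
    by (auto simp: leibniz_env_def)
  from assms R have wf: "wf_rule ar (l, r)" by (auto simp: ran_def)
  let ?n = "length (fv_list l)"
  let ?Ks = "Arr Star # replicate ?n Star"
  have closed: "\<not> tfree i T" for i
    unfolding T leibniz_eq tfree_foldr_TAll by (auto simp: tfree_ty_inst)
  have "formula ar \<Delta> T" for \<Delta>
    unfolding T leibniz_eq
  proof (rule formula_foldr_TAll)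
    let ?\<Delta> = "foldl (\<lambda>\<Delta> K. case_nat K \<Delta>) \<Delta> ?Ks"
    have p: "kinded ar ?\<Delta> (TVar ?n) (Arr Star)"
      using kinded.intros(2)[of ar ?\<Delta> ?n] foldl_case_nat[of ?n ?Ks \<Delta>] by simp
    have x: "kinded ar ?\<Delta> (TVar (?n - 1 - var_pos l x)) Star" if "x \<in> set (occs l)" for x
    proof -
      \<comment> \<open>The position is \<open>Suc (var_pos l x)\<close>, beyond the kind of
        \<open>p\<close> at the front.\<close>
      have "?Ks ! (length ?Ks - 1 - (?n - 1 - var_pos l x)) = Star"
        using var_pos_less[OF that] by (auto simp: nth_Cons' )
      then show ?thesis
        using kinded.intros(2)[of ar ?\<Delta> "?n - 1 - var_pos l x"] foldl_case_nat[of "?n - 1 - var_pos l x" ?Ks \<Delta>]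
        by simp
    qed
    from wf p x show "formula ar ?\<Delta> (leibniz_body ?n (\<lambda>x. TVar (?n - 1 - var_pos l x)) (l, r))"
      unfolding wf_rule_def by (auto intro!: formula.intros(2) formula.intros(1)[OF kinded.intros(4)] kinded_ty_inst)
  qed
  with closed show "(\<forall>c. tlift c T = T) \<and> (\<forall>c S. tsubst c S T = T) \<and> (\<forall>\<Delta>. formula ar \<Delta> T)"
    by (simp add: not_tfree_tlift not_tfree_tsubst)
qed

subsection \<open>Instantiating quantifier prefixes\<close>

text \<open>Grows at the right end, like a spine of \<open>ETApp\<close>. \<open>insts_TAllD\<close>
  gives the opposite view, in which the outermost quantifier is peeled off.\<close>

inductive insts :: "('f \<Rightarrow> nat) \<Rightarrow> (nat \<Rightarrow> kind) \<Rightarrow> 'f ty \<Rightarrow> 'f ty list \<Rightarrow> 'f ty \<Rightarrow> bool" for ar \<Delta> T where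
  insts_Nil: "insts ar \<Delta> T [] T"
| insts_snoc: "insts ar \<Delta> T Ts (TAll K U) \<Longrightarrow> kinded ar \<Delta> S K \<Longrightarrow> insts ar \<Delta> T (Ts @ [S]) (tsubst 0 S U)"

lemma insts_TImpD: "insts ar \<Delta> (TImp A B) Ts V \<Longrightarrow> Ts = [] \<and> V = TImp A B"
  by (induct rule: insts.induct) auto

lemma insts_TAllD:
  "insts ar \<Delta> (TAll K U) Ts V \<Longrightarrow> Ts = [] \<and> V = TAll K U \<or>
   (\<exists>S Ss. Ts = S # Ss \<and> kinded ar \<Delta> S K \<and> insts ar \<Delta> (tsubst 0 S U) Ss V)"
  by (induct rule: insts.induct) (auto intro: insts.intros)

text \<open>Instantiation keeps this shape, and conversion to an implication or a quantification
  tells which of the two the type itself is. So a declared type can be instantiated syntactically in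
  spite of \<open>Conv\<close>.\<close>

fun prenex :: "'f ty \<Rightarrow> bool" where
  "prenex (TImp A B) = True"
| "prenex (TAll K T) = prenex T"
| "prenex _ = False"

lemma prenex_tsubst: "prenex T \<Longrightarrow> prenex (tsubst c S T)"
  by (induct T arbitrary: c S rule: prenex.induct) auto

lemma prenex_foldr_TAll: "prenex (foldr TAll Ks T) = prenex T"
  by (induct Ks) auto

lemma prenex_conv_TImpD: "prenex V \<Longrightarrow> conv V (TImp A B) \<Longrightarrow> \<exists>A' B'. V = TImp A' B' \<and> conv A' A \<and> conv B' B"
  by (cases V rule: prenex.cases) (auto dest: conv_TImpD simp: not_conv_TAll_TImp)

lemma prenex_conv_TAllD: "prenex V \<Longrightarrow> conv V (TAll K A) \<Longrightarrow> \<exists>A'. V = TAll K A' \<and> conv A' A"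
  by (cases V rule: prenex.cases) (auto dest: conv_TAllD simp: not_conv_TImp_TAll)

lemma prenex_not_conv_kinded:
  assumes "prenex V" and "kinded ar \<Delta> T K"
  shows "\<not> conv V T"
proof
  assume "conv V T"
  then have "conv T V" by (rule equivclp_sym)
  with assms show False
    using not_conv_kinded_TImp not_conv_kinded_TAll by (cases V) (simp_all, blast+)
qed

text \<open>Conversions made between the instantiations are pushed to the end, so \<open>V\<close>
  is an exact instance of the declared type.\<close>

lemma typing_tspineD:
  "typing ar \<Sigma> \<Delta> \<Gamma> (foldl ETApp (ECon k) Ts) T \<Longrightarrow> \<Sigma> k = Some U \<Longrightarrow> prenex U \<Longrightarrow>
   \<exists>V. insts ar \<Delta> U Ts V \<and> prenex V \<and> conv V T"
proof (induct Ts arbitrary: T rule: rev_induct)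
  case Nil
  then show ?case by (auto dest!: typing_EConD intro: insts.intros)
next
  case (snoc S Ts)
  from snoc.prems(1) obtain K A where
    A: "typing ar \<Sigma> \<Delta> \<Gamma> (foldl ETApp (ECon k) Ts) (TAll K A)" "kinded ar \<Delta> S K" "conv (tsubst 0 S A) T"
    by (auto dest: typing_ETAppD)
  from snoc.hyps[OF A(1) snoc.prems(2,3)] obtain V where
    V: "insts ar \<Delta> U Ts V" "prenex V" "conv V (TAll K A)" by blast
  from prenex_conv_TAllD[OF V(2,3)] obtain A' where A': "V = TAll K A'" "conv A' A" by blast
  from V(1)[unfolded A'(1)] A(2) have "insts ar \<Delta> U (Ts @ [S]) (tsubst 0 S A')"
    by (rule insts.intros)
  moreover have "prenex (tsubst 0 S A')" using V(2) A'(1) by (auto intro: prenex_tsubst)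
  moreover have "conv (tsubst 0 S A') T"
    using conv_tsubst[OF A'(2)] A(3) by (rule equivclp_trans)
  ultimately show ?case by blast
qed

lemma typing_tspine_const:
  "typing ar \<Sigma> \<Delta> \<Gamma> (foldl ETApp (ECon k) Ts) T \<Longrightarrow> \<exists>U. \<Sigma> k = Some U"
  by (induct Ts arbitrary: T rule: rev_induct) (auto dest!: typing_EConD typing_ETAppD)

text \<open>The first type replaces the variable with the largest index, as the outermost quantifier is
  instantiated first.\<close>

fun msubst :: "'f ty list \<Rightarrow> 'f ty \<Rightarrow> 'f ty" where
  "msubst [] T = T"
| "msubst (S # Ss) T = msubst Ss (tsubst (length Ss) ((tlift 0 ^^ length Ss) S) T)"

lemma tsubst_tlift_funpow:
  "tsubst j ((tlift 0 ^^ j) S) (tlift 0 ((tlift 0 ^^ j) T)) = (tlift 0 ^^ j) T"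
proof (induct j)
  case (Suc j)
  then show ?case
    using tlift_tsubst_le[of 0 j "(tlift 0 ^^ j) S" "tlift 0 ((tlift 0 ^^ j) T)"] by simp
qed auto

lemma msubst_tlift_funpow: "msubst Ss ((tlift 0 ^^ length Ss) T) = T"
  by (induct Ss) (auto simp: tsubst_tlift_funpow)

lemma msubst_TVar: "i < length Ss \<Longrightarrow> msubst Ss (TVar i) = Ss ! (length Ss - 1 - i)"
  by (induct Ss arbitrary: i) (auto simp: msubst_tlift_funpow nth_Cons')

lemma msubst_TImp: "msubst Ss (TImp A B) = TImp (msubst Ss A) (msubst Ss B)"
  by (induct Ss arbitrary: A B) auto

lemma msubst_TApp: "msubst Ss (TApp A B) = TApp (msubst Ss A) (msubst Ss B)"
  by (induct Ss arbitrary: A B) auto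

lemma msubst_ty_inst: "msubst Ss (ty_inst \<theta> t) = ty_inst (msubst Ss \<circ> \<theta>) t"
  by (induct Ss arbitrary: \<theta>) (auto simp: tsubst_ty_inst comp_def)

lemma tsubst_foldr_TAll:
  "tsubst c S (foldr TAll Ks T) = foldr TAll Ks (tsubst (c + length Ks) ((tlift 0 ^^ length Ks) S) T)"
  by (induct Ks arbitrary: c S) (auto simp: funpow_swap1)

lemma insts_foldr_TAll:
  "insts ar \<Delta> (foldr TAll Ks (TImp A B)) Ts (TImp A' B') \<Longrightarrow>
   list_all2 (kinded ar \<Delta>) Ts Ks \<and> TImp A' B' = msubst Ts (TImp A B)"
proof (induct Ks arbitrary: A B Ts)
  case Nil
  then show ?case by (auto dest: insts_TImpD)
next
  case (Cons K Ks)
  from insts_TAllD[of ar \<Delta> K "foldr TAll Ks (TImp A B)" Ts "TImp A' B'"] Cons.prems obtain S Ss where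
    "Ts = S # Ss" "kinded ar \<Delta> S K"
    "insts ar \<Delta> (tsubst 0 S (foldr TAll Ks (TImp A B))) Ss (TImp A' B')"
    by auto
  with Cons.hyps[of _ _ Ss] show ?case
    by (fastforce simp: tsubst_foldr_TAll dest: list_all2_lengthD)
qed

text \<open>Application to evidence requires an implication, and this forces all quantifiers of the
  Leibniz type to be instantiated.\<close>

lemma leibniz_spine:
  assumes rules: "\<forall>\<rho>\<in>ran R. wf_rule ar \<rho>"
    and "typing ar (leibniz_env R) \<Delta> \<Gamma> (EApp (foldl ETApp (ECon k) Ts) e) T"
  obtains l r P ts A where "R k = Some (l, r)" "Ts = P # ts" "length ts = length (fv_list l)"
    "kinded ar \<Delta> P (Arr Star)" "\<forall>S\<in>set ts. kinded ar \<Delta> S Star"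
    "typing ar (leibniz_env R) \<Delta> \<Gamma> e A"
    "conv A (TApp P (ty_inst (\<lambda>x. ts ! var_pos l x) r))"
    "conv (TApp P (ty_inst (\<lambda>x. ts ! var_pos l x) l)) T"
proof -
  from typing_EAppD[OF assms(2)] obtain A B where
    spine: "typing ar (leibniz_env R) \<Delta> \<Gamma> (foldl ETApp (ECon k) Ts) (TImp A B)"
    and e: "typing ar (leibniz_env R) \<Delta> \<Gamma> e A" and B: "conv B T"
    by blast
  obtain l r where R: "R k = Some (l, r)"
    using typing_tspine_const[OF spine] by (auto simp: leibniz_env_def)
  with rules have vars: "set (occs r) \<subseteq> set (occs l)"
    by (auto simp: wf_rule_def ran_def)
  let ?n = "length (fv_list l)"
  let ?\<theta> = "\<lambda>x. TVar (?n - 1 - var_pos l x)"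
  have const: "leibniz_env R k = Some (leibniz (l, r))" using R by (simp add: leibniz_env_def)
  have "prenex (leibniz (l, r))" unfolding leibniz_eq prenex_foldr_TAll by simp
  from typing_tspineD[OF spine const this, unfolded leibniz_eq] obtain V where
    V: "insts ar \<Delta> (foldr TAll (Arr Star # replicate ?n Star) (leibniz_body ?n ?\<theta> (l, r))) Ts V"
      "prenex V" "conv V (TImp A B)"
    by blast
  from prenex_conv_TImpD[OF V(2,3)] obtain A' B' where V': "V = TImp A' B'" "conv A' A" "conv B' B"
    by blast
  from insts_foldr_TAll[OF V(1)[unfolded V'(1)]]
  have kinds: "list_all2 (kinded ar \<Delta>) Ts (Arr Star # replicate ?n Star)"
    and inst: "TImp A' B' = msubst Ts (leibniz_body ?n ?\<theta> (l, r))"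
    by blast+
  from kinds obtain P ts where Ts: "Ts = P # ts" "kinded ar \<Delta> P (Arr Star)"
    "list_all2 (kinded ar \<Delta>) ts (replicate ?n Star)"
    by (auto simp: list_all2_Cons2)
  from Ts(3) have len: "length ts = ?n" by (auto dest: list_all2_lengthD)
  have ts: "\<forall>S\<in>set ts. kinded ar \<Delta> S Star"
    using Ts(3) by (auto simp: list_all2_conv_all_nth in_set_conv_nth)
  have "msubst Ts (TVar ?n) = P"
    using Ts(1) len by (simp add: msubst_TVar del: msubst.simps)
  moreover have "msubst Ts (ty_inst ?\<theta> t) = ty_inst (\<lambda>x. ts ! var_pos l x) t"
    if "set (occs t) \<subseteq> set (occs l)" for t
    unfolding msubst_ty_inst
  proof (rule ty_inst_cong)
    fix x assume "x \<in> set (occs t)"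
    with that have "var_pos l x < ?n" by (auto intro: var_pos_less)
    \<comment> \<open>The reversal in \<open>msubst_TVar\<close> cancels the one in
      \<open>?\<theta>\<close>; the remaining shift by one skips \<open>P\<close>.\<close>
    then show "(msubst Ts \<circ> ?\<theta>) x = ts ! var_pos l x"
      using Ts(1) len by (simp add: msubst_TVar del: msubst.simps)
  qed
  ultimately have "A' = TApp P (ty_inst (\<lambda>x. ts ! var_pos l x) r)"
    "B' = TApp P (ty_inst (\<lambda>x. ts ! var_pos l x) l)"
    using inst vars by (auto simp: msubst_TImp msubst_TApp)
  with V' B have "conv A (TApp P (ty_inst (\<lambda>x. ts ! var_pos l x) r))"
    "conv (TApp P (ty_inst (\<lambda>x. ts ! var_pos l x) l)) T"
    by (auto intro: equivclp_sym equivclp_trans)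
  with R Ts(1) len Ts(2) ts e show ?thesis by (rule that)
qed

section \<open>Traces of hereditarily head normalizing evidence\<close>

definition rule_subst :: "'f trm \<Rightarrow> 'f trm list \<Rightarrow> nat \<Rightarrow> 'f trm" where
  "rule_subst l ts x = (case map_of (zip (fv_list l) ts) x of Some t \<Rightarrow> t | None \<Rightarrow> Var x)"

lemma rule_subst_eq_nth:
  assumes "x \<in> set (occs l)" and "length ts = length (fv_list l)"
  shows "rule_subst l ts x = ts ! var_pos l x"
  using map_of_zip_nth[of "fv_list l" ts "var_pos l x"] assms
  by (simp add: rule_subst_def var_pos_less nth_var_pos)

lemma conv_onormal_eq: "conv T N \<Longrightarrow> onormal T \<Longrightarrow> onormal N \<Longrightarrow> T = N"
  by (metis conv_onormal_osteps onormal_osteps_eq)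

text \<open>A normal type of kind \<open>* \<Rightarrow> *\<close> acts as the abstraction of a type \<open>N\<close> of kind \<open>*\<close>, possibly after
  eta-expansion.\<close>

lemma abstraction_body:
  assumes P: "kinded ar \<Delta> P (Arr Star)" "onormal P"
  obtains N where "kinded ar (case_nat Star \<Delta>) N Star" "tfree 0 N"
    "\<And>S. conv (TApp P S) (tsubst 0 S N)"
    "\<And>S. kinded ar \<Delta> S Star \<Longrightarrow> onormal S \<Longrightarrow> onormal (tsubst 0 S N)"
    "\<And>C. N = ctxt_body C \<Longrightarrow> denotes_ctxt P C"
proof (cases "\<exists>N. P = TLam N")
  case True
  then obtain N where N: "P = TLam N" by blast
  show ?thesis
  proof (rule that)
    show "kinded ar (case_nat Star \<Delta>) N Star" "tfree 0 N"
      using P(1) N by (auto elim: kinded_TLamE)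
    show "conv (TApp P S) (tsubst 0 S N)" for S
      unfolding N by (rule r_into_equivclp) (rule ostep.intros)
    show "onormal (tsubst 0 S N)" if "kinded ar \<Delta> S Star" "onormal S" for S
      using P(2) N that kinded_Star_not_TLam by (auto intro!: onormal_tsubst)
    show "denotes_ctxt P C" if "N = ctxt_body C" for C
      using N that by (simp add: denotes_ctxt_def)
  qed
next
  case False
  show ?thesis
  proof (rule that[of "TApp (tlift 0 P) (TVar 0)"])
    show "kinded ar (case_nat Star \<Delta>) (TApp (tlift 0 P) (TVar 0)) Star"
      using kinded_case_nat_tlift[OF P(1), of Star] kinded.intros(2)[of ar "case_nat Star \<Delta>" 0]
      by (auto intro: kinded.intros(4))
    show "onormal (tsubst 0 S (TApp (tlift 0 P) (TVar 0)))" if "kinded ar \<Delta> S Star" "onormal S" for S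
      using P(2) False that by simp
    show "denotes_ctxt P C" if "TApp (tlift 0 P) (TVar 0) = ctxt_body C" for C
      using that by (simp add: denotes_ctxt_def)
  qed simp_all
qed

lemma leibniz_action:
  assumes rule: "wf_rule ar (l, r)"
    and P: "kinded ar \<Delta> P (Arr Star)" "onormal P"
    and Ts: "\<forall>S\<in>set Ts. kinded ar \<Delta> S Star" "\<forall>S\<in>set Ts. onormal S" "length Ts = length (fv_list l)"
    and conv: "conv (TApp P (ty_inst (\<lambda>x. Ts ! var_pos l x) l)) (ty_of t)"
  obtains C ts where "denotes_ctxt P C" "Ts = map ty_of ts" "length ts = length (fv_list l)"
    "t = fill C (replicate (holes C) (subst (rule_subst l ts) l))"
    "conv (TApp P (ty_inst (\<lambda>x. Ts ! var_pos l x) r))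
       (ty_of (fill C (replicate (holes C) (subst (rule_subst l ts) r))))"
proof -
  let ?\<theta> = "\<lambda>x. Ts ! var_pos l x"
  let ?S = "ty_inst ?\<theta> l"
  from rule have wf: "wf_trm ar l" and vars: "set (occs r) \<subseteq> set (occs l)"
    by (auto simp: wf_rule_def)
  have in_Ts: "?\<theta> x \<in> set Ts" if "x \<in> set (occs l)" for x
    using var_pos_less[OF that] Ts(3) by simp
  have S: "kinded ar \<Delta> ?S Star" "onormal ?S"
    using wf in_Ts Ts(1,2) by (auto intro: kinded_ty_inst onormal_ty_inst)
  from abstraction_body[OF P] obtain N where
    N: "kinded ar (case_nat Star \<Delta>) N Star" "tfree 0 N"
      "\<And>S. conv (TApp P S) (tsubst 0 S N)"
      "\<And>S. kinded ar \<Delta> S Star \<Longrightarrow> onormal S \<Longrightarrow> onormal (tsubst 0 S N)"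
      "\<And>C. N = ctxt_body C \<Longrightarrow> denotes_ctxt P C" by blast
  have "conv (tsubst 0 ?S N) (ty_of t)"
    using equivclp_sym[OF N(3)] conv by (rule equivclp_trans)
  then have eq: "tsubst 0 ?S N = ty_of t"
    using N(4)[OF S] onormal_ty_of by (rule conv_onormal_eq)
  \<comment> \<open>The bound variable occurs in \<open>N\<close>, so \<open>?S\<close> really shows
    up inside \<open>ty_of t\<close> and must be a first-order term.\<close>
  with tsubst_eq_ty_ofD[OF N(1) refl] N(2) obtain C s where C: "N = ctxt_body C" and s: "?S = ty_of s"
    by blast
  \<comment> \<open>Each type argument belongs to a variable occurring in \<open>l\<close>, hence it
    is found inside \<open>s\<close>.\<close>
  have "\<exists>u. T = ty_of u" if "T \<in> set Ts" for T
  proof -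
    from that obtain i where i: "i < length (fv_list l)" "T = Ts ! i"
      using Ts(3) by (auto simp: in_set_conv_nth)
    then have "fv_list l ! i \<in> set (occs l)" by (metis nth_mem set_fv_list)
    from ty_inst_eq_ty_ofD[OF s this] i show ?thesis by (simp add: var_pos_nth)
  qed
  then have "\<exists>ts. Ts = map ty_of ts" unfolding ex_map_conv by blast
  then obtain ts where ts: "Ts = map ty_of ts" by blast
  with Ts(3) have len: "length ts = length (fv_list l)" by simp
  have inst: "ty_inst ?\<theta> u = ty_of (subst (rule_subst l ts) u)" if "set (occs u) \<subseteq> set (occs l)" for u
    unfolding ty_of_subst
  proof (rule ty_inst_cong)
    fix x assume "x \<in> set (occs u)"
    with that have "x \<in> set (occs l)" by blast
    then show "?\<theta> x = (ty_of \<circ> rule_subst l ts) x"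
      using len var_pos_less[of x l] by (simp add: ts rule_subst_eq_nth)
  qed
  have "t = fill C (replicate (holes C) (subst (rule_subst l ts) l))"
    using eq unfolding C inst[OF subset_refl] tsubst_ctxt_body by (simp add: ty_of_inject)
  moreover have "conv (TApp P (ty_inst ?\<theta> r)) (ty_of (fill C (replicate (holes C) (subst (rule_subst l ts) r))))"
    using N(3)[of "ty_inst ?\<theta> r"] unfolding C inst[OF vars] tsubst_ctxt_body .
  ultimately show ?thesis using that N(5)[OF C] ts len by blast
qed

section \<open>Existence and shape of the trace\<close>

lemma HN_imp_wh_normalizing:
  assumes "e \<in> HN (Suc n)"
  obtains r where "wh_step\<^sup>*\<^sup>* e r" "\<nexists>r'. wh_step r r'"
proof -
  have "\<not> wh_step (RLam a) r'" for a :: "'a raw" and r'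
    by (auto elim: wh_step.cases)
  moreover have "\<not> wh_step (foldl RApp h es) r'" if "is_atom h" for h :: "'a raw" and es r'
    using that
  proof (induct es arbitrary: r' rule: rev_induct)
    case (snoc x es)
    then have "\<forall>a. foldl RApp h es \<noteq> RLam a"
      by (cases es rule: rev_cases) (auto simp: is_atom_def)
    with snoc show ?case by (auto elim: wh_step.cases)
  qed (auto simp: is_atom_def elim: wh_step.cases)
  ultimately show ?thesis using HN_weak_head_normalizing[OF assms] that by blast
qed

lemma applied_leibniz_kinded:
  assumes rules: "\<forall>\<rho>\<in>ran R. wf_rule ar \<rho>"
    and "typing ar (leibniz_env R) \<Delta> \<Gamma> (EApp (foldl ETApp (ECon k) Ts) a) T"
  shows "\<exists>U. kinded ar \<Delta> U Star \<and> conv U T"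
proof -
  from leibniz_spine[OF assms] obtain l r P Ss where
    R: "R k = Some (l, r)" and len: "length Ss = length (fv_list l)"
    and P: "kinded ar \<Delta> P (Arr Star)" and Ss: "\<forall>S\<in>set Ss. kinded ar \<Delta> S Star"
    and conv: "conv (TApp P (ty_inst (\<lambda>x. Ss ! var_pos l x) l)) T" .
  have "wf_trm ar l" using rules R by (auto simp: ran_def wf_rule_def)
  moreover have "Ss ! var_pos l x \<in> set Ss" if "x \<in> set (occs l)" for x
    using var_pos_less[OF that] len by simp
  ultimately have "kinded ar \<Delta> (ty_inst (\<lambda>x. Ss ! var_pos l x) l) Star"
    using Ss by (auto intro: kinded_ty_inst)
  with P have "kinded ar \<Delta> (TApp P (ty_inst (\<lambda>x. Ss ! var_pos l x) l)) Star"
    by (rule kinded.intros(4))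
  with conv show ?thesis by blast
qed

text \<open>Instances of a Leibniz type remain quantifications or implications, so a constant must
  have received its evidence before a first-order type is reached.\<close>

lemma tspine_leibniz_not_kinded:
  assumes "typing ar (leibniz_env R) \<Delta> \<Gamma> (foldl ETApp (ECon k) Ts) T"
  shows "\<not> kinded ar \<Delta> T K"
proof -
  from typing_tspine_const[OF assms] obtain l r where k: "leibniz_env R k = Some (leibniz (l, r))"
    by (auto simp: leibniz_env_def)
  have "prenex (leibniz (l, r))" unfolding leibniz_eq prenex_foldr_TAll by simp
  from typing_tspineD[OF assms k this] prenex_not_conv_kinded show ?thesis by blast
qed

lemma tspine_normalizing:
  "\<forall>S\<in>set Ts. \<exists>N. ostep\<^sup>*\<^sup>* S N \<and> onormal N \<Longrightarrow>
   \<exists>Ns. htauo_step\<^sup>*\<^sup>* (foldl ETApp e Ts) (foldl ETApp e Ns) \<and> (\<forall>S\<in>set Ns. onormal S)"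
proof (induct Ts rule: rev_induct)
  case Nil
  show ?case by (intro exI[of _ "[]"]) simp
next
  case (snoc S Ts)
  then obtain Ns N where Ns: "htauo_step\<^sup>*\<^sup>* (foldl ETApp e Ts) (foldl ETApp e Ns)"
    "\<forall>S\<in>set Ns. onormal S" and N: "ostep\<^sup>*\<^sup>* S N" "onormal N" by auto
  have "htauo_step\<^sup>*\<^sup>* (ETApp (foldl ETApp e Ts) S) (ETApp (foldl ETApp e Ns) N)"
    using htauo_steps_TApp[OF Ns(1)] htauo_steps_TApp_arg[OF N(1)] by (rule rtranclp_trans)
  with Ns(2) N(2) show ?case by (intro exI[of _ "Ns @ [N]"]) auto
qed

text \<open>The empty context leaves only constants at the head. After its one evidence argument the
  type converts to one of kind \<open>Star\<close>, which permits neither sort of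
  application.\<close>

lemma neutral_leibniz:
  assumes rules: "\<forall>\<rho>\<in>ran R. wf_rule ar \<rho>"
  shows "neutral e \<Longrightarrow> typing ar (leibniz_env R) \<Delta> [] e T \<Longrightarrow>
    (\<exists>k Ts. e = foldl ETApp (ECon k) Ts) \<or> (\<exists>k Ts a. e = EApp (foldl ETApp (ECon k) Ts) a)"
proof (induct e arbitrary: T)
  case (EVar i)
  then show ?case by (auto dest: typing_EVarD)
next
  case (ECon k)
  have "ECon k = foldl ETApp (ECon k) []" by simp
  then show ?case by blast
next
  case (EApp e a)
  from EApp.prems obtain A B where e: "typing ar (leibniz_env R) \<Delta> [] e (TImp A B)"
    by (auto dest: typing_EAppD)
  have "\<nexists>k Ts a. e = EApp (foldl ETApp (ECon k) Ts) a"
    using e applied_leibniz_kinded[OF rules] not_conv_kinded_TImp by blast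
  with EApp.hyps(1)[OF _ e] EApp.prems show ?case by auto
next
  case (ETApp e S)
  from ETApp.prems obtain K A where e: "typing ar (leibniz_env R) \<Delta> [] e (TAll K A)"
    by (auto dest: typing_ETAppD)
  have "\<nexists>k Ts a. e = EApp (foldl ETApp (ECon k) Ts) a"
    using e applied_leibniz_kinded[OF rules] not_conv_kinded_TAll by blast
  with ETApp.hyps[OF _ e] ETApp.prems obtain k Ts where "e = foldl ETApp (ECon k) Ts" by auto
  then have "ETApp e S = foldl ETApp (ECon k) (Ts @ [S])" by simp
  then show ?case by blast
qed auto

lemma trace_form_exists:
  assumes rules: "\<forall>\<rho>\<in>ran R. wf_rule ar \<rho>"
    and e: "typing ar (leibniz_env R) \<Delta> [] e (ty_of t)" and "e \<in> HHN"
  shows "\<exists>q. trace_form e q"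
proof -
  note \<Sigma> = valid_consts_leibniz_env[OF rules]
  have T: "kinded ar \<Delta> (ty_of t) Star"
    using typing_formula[OF \<Sigma> e] by (auto intro: formula_ty_of_kinded)
  \<comment> \<open>One level of \<open>HN\<close> yields one entry of the trace; the deeper levels
    are handed on to the evidence argument.\<close>
  from assms(3) have "erase e \<in> HN (Suc 0)" by (simp add: HHN_def del: HN.simps)
  then obtain r where "wh_step\<^sup>*\<^sup>* (erase e) r" and r: "\<nexists>r'. wh_step r r'"
    by (rule HN_imp_wh_normalizing)
  with lift_wh_steps[OF \<Sigma> e] obtain e1 where e1: "htauo_step\<^sup>*\<^sup>* e e1" "erase e1 = r" by auto
  have "typing ar (leibniz_env R) \<Delta> [] e1 (ty_of t)"
    using subject_reductions[OF \<Sigma> e _ e1(1)] by simp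
  from expose_whnf[OF \<Sigma> this] r e1(2) obtain e2 where e2: "htauo_step\<^sup>*\<^sup>* e1 e2"
    "(\<exists>b. e2 = ELam b) \<or> (\<exists>b. e2 = ETLam b) \<or> neutral e2" by auto
  from e1(1) e2(1) have red: "htauo_step\<^sup>*\<^sup>* e e2" by (rule rtranclp_trans)
  have typed: "typing ar (leibniz_env R) \<Delta> [] e2 (ty_of t)"
    using subject_reductions[OF \<Sigma> e _ red] by simp
  have "\<nexists>b. e2 = ELam b"
    using typed not_conv_kinded_TImp[OF T] by (auto dest!: typing_ELamD intro: equivclp_sym)
  moreover have "\<nexists>b. e2 = ETLam b"
    using typed not_conv_kinded_TAll[OF T] by (auto dest!: typing_ETLamD intro: equivclp_sym)
  ultimately have "neutral e2" using e2(2) by blast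
  moreover have "\<nexists>k Ts. e2 = foldl ETApp (ECon k) Ts"
    using typed T by (auto dest: tspine_leibniz_not_kinded)
  ultimately obtain k Ts a where e2_eq: "e2 = EApp (foldl ETApp (ECon k) Ts) a"
    using neutral_leibniz[OF rules _ typed] by blast
  have "\<forall>S\<in>set Ts. \<exists>N. ostep\<^sup>*\<^sup>* S N \<and> onormal N"
    by (rule leibniz_spine[OF rules typed[unfolded e2_eq]]) (auto dest: kinded_normalizing)
  then obtain Ns where Ns: "htauo_step\<^sup>*\<^sup>* (foldl ETApp (ECon k) Ts) (foldl ETApp (ECon k) Ns)"
    "\<forall>S\<in>set Ns. onormal S"
    using tspine_normalizing by blast
  have "htauo_step\<^sup>*\<^sup>* e (EApp (foldl ETApp (ECon k) Ns) a)"
    using red htauo_steps_App[OF Ns(1)] unfolding e2_eq by (rule rtranclp_trans)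
  with Ns(2) have "trace_form e (k, Ns, a)" by (simp add: trace_form_def)
  then show ?thesis ..
qed

text \<open>Stated for every reduct of the required form, so the choice that \<open>SOME\<close>
  makes in \<open>trace_next\<close> has no influence.\<close>

lemma trace_form_acts:
  assumes rules: "\<forall>\<rho>\<in>ran R. wf_rule ar \<rho>"
    and e: "typing ar (leibniz_env R) \<Delta> [] e (ty_of t)" and hhn: "e \<in> HHN"
    and "trace_form e (k, Ts, e')"
  obtains l r P C ts where "R k = Some (l, r)" "Ts = P # map ty_of ts" "denotes_ctxt P C"
    "length ts = length (fv_list l)"
    "t = fill C (replicate (holes C) (subst (rule_subst l ts) l))"
    "typing ar (leibniz_env R) \<Delta> [] e' (ty_of (fill C (replicate (holes C) (subst (rule_subst l ts) r))))"
    "e' \<in> HHN"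
proof -
  note \<Sigma> = valid_consts_leibniz_env[OF rules]
  from assms(4) have red: "htauo_step\<^sup>*\<^sup>* e (EApp (foldl ETApp (ECon k) Ts) e')"
    and normal: "\<forall>S\<in>set Ts. onormal S"
    by (auto simp: trace_form_def)
  have "typing ar (leibniz_env R) \<Delta> [] (EApp (foldl ETApp (ECon k) Ts) e') (ty_of t)"
    using subject_reductions[OF \<Sigma> e _ red] by simp
  from leibniz_spine[OF rules this] obtain l r P Ss A where
    R: "R k = Some (l, r)" and Ts: "Ts = P # Ss" and len: "length Ss = length (fv_list l)"
    and P: "kinded ar \<Delta> P (Arr Star)" and Ss: "\<forall>S\<in>set Ss. kinded ar \<Delta> S Star"
    and e': "typing ar (leibniz_env R) \<Delta> [] e' A"
    and A: "conv A (TApp P (ty_inst (\<lambda>x. Ss ! var_pos l x) r))"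
    and t: "conv (TApp P (ty_inst (\<lambda>x. Ss ! var_pos l x) l)) (ty_of t)" by blast
  from rules R have rule: "wf_rule ar (l, r)" by (auto simp: ran_def)
  from normal Ts have "onormal P" "\<forall>S\<in>set Ss. onormal S" by auto
  from leibniz_action[OF rule P this(1) Ss this(2) len t] obtain C ts where
    C: "denotes_ctxt P C" "Ss = map ty_of ts" "length ts = length (fv_list l)"
      "t = fill C (replicate (holes C) (subst (rule_subst l ts) l))"
      "conv (TApp P (ty_inst (\<lambda>x. Ss ! var_pos l x) r))
         (ty_of (fill C (replicate (holes C) (subst (rule_subst l ts) r))))" .
  let ?u = "fill C (replicate (holes C) (subst (rule_subst l ts) r))"
  have "conv A (ty_of ?u)" using A C(5) by (rule equivclp_trans)
  \<comment> \<open>Conversion to the normal type \<open>ty_of ?u\<close> is reduction, which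
    preserves formulas; \<open>Conv\<close> asks for this.\<close>
  moreover from this have "formula ar \<Delta> (ty_of ?u)"
    using typing_formula[OF \<Sigma> e'] conv_onormal_osteps[OF _ onormal_ty_of] formula_osteps by force
  ultimately have "typing ar (leibniz_env R) \<Delta> [] e' (ty_of ?u)"
    using e' by (blast intro: typing.Conv)
  moreover have "e' \<in> HHN"
  proof -
    have erase_tspine: "erase (foldl ETApp e Ts) = erase e" for e :: "('b, 'a) evid" and Ts
      by (induct Ts arbitrary: e) auto
    have "RApp (RCon k) (erase e') \<in> HN (Suc n)" for n
      using HHN_htauo_steps[OF red hhn] by (simp add: HHN_def erase_tspine del: HN.simps)
    then show ?thesis by (auto simp: HHN_def intro: HN_Con_AppD)
  qed
  ultimately show ?thesis using that R Ts C by blast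
qed

section \<open>Actions\<close>

text \<open>Turns the fixed siblings of a rewritten argument into parts of a one-hole
  context.\<close>

primrec const_ctxt :: "'f trm \<Rightarrow> 'f ctxt" where
  "const_ctxt (Var x) = CVar x"
| "const_ctxt (Fun f ts) = CFun f (map const_ctxt ts)"

lemma holes_const_ctxt [simp]: "holes (const_ctxt t) = 0"
  by (induct t) auto

lemma fill_const_ctxt [simp]: "fill (const_ctxt t) us = t"
proof (induct t arbitrary: us)
  case (Fun f ts)
  then have "fills (map const_ctxt ts) us = ts"
    by (induct ts) auto
  then show ?case by simp
qed auto

lemma rewrite_Fun:
  assumes "rewrite Rs s t"
  shows "rewrite Rs (Fun f (us @ s # vs)) (Fun f (us @ t # vs))"
  using assms
proof cases
  case (1 l r C \<sigma>)
  let ?D = "CFun f (map const_ctxt us @ C # map const_ctxt vs)"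
  have holes: "sum_list (map (holes \<circ> const_ctxt) ws) = 0" for ws :: "'a trm list"
    by (induct ws) auto
  have "fills (map const_ctxt us @ C # map const_ctxt vs) [w] = us @ fill C [w] # vs" for w
  proof -
    have "fills (map const_ctxt vs) ws = vs" for ws
      by (induct vs arbitrary: ws) auto
    then show ?thesis using 1(4) by (induct us) auto
  qed
  moreover have "holes ?D = 1" using 1(4) holes by (simp add: comp_def)
  ultimately show ?thesis
    using rewrite.intros[OF 1(3), of ?D \<sigma>] 1 by simp
qed

text \<open>The prefix \<open>us\<close> collects the arguments already rewritten, so the induction
  can run from left to right.\<close>

lemma rewrites_Fun:
  "list_all2 (rewrite Rs)\<^sup>*\<^sup>* ts ts' \<Longrightarrow> (rewrite Rs)\<^sup>*\<^sup>* (Fun f (us @ ts)) (Fun f (us @ ts'))"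
proof (induct ts ts' arbitrary: us rule: list_all2_induct)
  case (Cons t ts t' ts')
  from Cons(1) have "(rewrite Rs)\<^sup>*\<^sup>* (Fun f (us @ t # ts)) (Fun f (us @ t' # ts))"
    by induct (auto intro: rtranclp.rtrancl_into_rtrancl rewrite_Fun)
  also have "(rewrite Rs)\<^sup>*\<^sup>* (Fun f (us @ t' # ts)) (Fun f (us @ t' # ts'))"
    using Cons(3)[of "us @ [t']"] by simp
  finally show ?case .
qed auto

lemma rewrites_fill:
  assumes "(l, r) \<in> Rs"
  shows "(rewrite Rs)\<^sup>*\<^sup>* (fill C (replicate (holes C) (subst \<sigma> l))) (fill C (replicate (holes C) (subst \<sigma> r)))"
proof (induct C)
  case Hole
  from rewrite.intros[OF assms, of Hole \<sigma>] show ?case by auto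
next
  case (CFun f Cs)
  then show ?case
    using rewrites_Fun[of Rs _ _ f "[]"] by (simp add: fills_replicate list_all2_conv_all_nth)
qed auto

text \<open>The definite description is well defined because all data of \<open>acts\<close> can be
  read off the trace: \<open>ty_of\<close> is injective and \<open>P\<close> denotes at most one
  context.\<close>

lemma action_eq:
  assumes tr: "trace m e = Some (k, P # map ty_of ts)" and C: "denotes_ctxt P C"
    and R: "R k = Some (l, r)" and len: "length ts = length (fv_list l)"
  shows "action R e m (fill C (replicate (holes C) (subst (rule_subst l ts) l))) =
    Some (fill C (replicate (holes C) (subst (rule_subst l ts) r)))"
proof -
  let ?t = "fill C (replicate (holes C) (subst (rule_subst l ts) l))"
  let ?u = "fill C (replicate (holes C) (subst (rule_subst l ts) r))"
  have "acts R e m ?t ?u"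
    using tr C R len by (rule acts.intros) (simp add: rule_subst_def fun_eq_iff)
  moreover have "u = ?u" if "acts R e m ?t u" for u
    using that
  proof cases
    case (1 k' P' ts' C' l' r' \<sigma>)
    have "P' # map ty_of ts' = P # map ty_of ts" and k: "k' = k"
      using 1(3) tr by simp_all
    then have P: "P' = P" and ts: "ts' = ts"
      by (simp_all add: inj_map_eq_map inj_def ty_of_inject)
    have C': "C' = C" using 1(4) C unfolding P by (rule denotes_ctxt_unique)
    have lr: "l' = l" "r' = r" using 1(5) R unfolding k by simp_all
    have \<sigma>: "\<sigma> = rule_subst l ts" using 1(7) unfolding lr ts by (simp add: fun_eq_iff rule_subst_def)
    show ?thesis using 1(2) unfolding C' lr \<sigma> .
  qed
  ultimately show ?thesis unfolding action_def by (metis (mono_tags, lifting) the_equality)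
qed

lemma action_Suc:
  assumes "trace_next e = Some (k, Ts, e')"
  shows "action R e (Suc i) = action R e' i"
proof -
  have "acts R e (Suc i) = acts R e' i"
    using assms by (simp add: fun_eq_iff acts.simps[of R e] acts.simps[of R e'])
  then show ?thesis by (intro ext) (simp only: action_def)
qed

lemma faithful_step:
  assumes rules: "\<forall>\<rho>\<in>ran R. wf_rule ar \<rho>"
    and e: "typing ar (leibniz_env R) \<Delta> [] e (ty_of t)" and hhn: "e \<in> HHN"
  obtains k Ts e' t' where "trace_next e = Some (k, Ts, e')" "action R e 0 t = Some t'"
    "(rewrite (ran R))\<^sup>*\<^sup>* t t'" "typing ar (leibniz_env R) \<Delta> [] e' (ty_of t')" "e' \<in> HHN"
proof -
  from trace_form_exists[OF assms] obtain k Ts e' where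
    next_e: "trace_next e = Some (k, Ts, e')" and form: "trace_form e (k, Ts, e')"
    by (metis prod_cases3 someI_ex trace_next_def)
  from trace_form_acts[OF assms form] obtain l r P C ts where
    R: "R k = Some (l, r)" and Ts: "Ts = P # map ty_of ts" and C: "denotes_ctxt P C"
    and len: "length ts = length (fv_list l)"
    and t: "t = fill C (replicate (holes C) (subst (rule_subst l ts) l))"
    and e': "typing ar (leibniz_env R) \<Delta> [] e' (ty_of (fill C (replicate (holes C) (subst (rule_subst l ts) r))))"
      "e' \<in> HHN" .
  have "trace 0 e = Some (k, P # map ty_of ts)" using next_e Ts by simp
  then have "action R e 0 t = Some (fill C (replicate (holes C) (subst (rule_subst l ts) r)))"
    unfolding t using C R len by (rule action_eq)
  moreover have "(rewrite (ran R))\<^sup>*\<^sup>* t (fill C (replicate (holes C) (subst (rule_subst l ts) r)))"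
    unfolding t using R by (intro rewrites_fill) (auto simp: ran_def)
  ultimately show ?thesis using that next_e e' by blast
qed

theorem theorem26:
  fixes ar :: "'f \<Rightarrow> nat" and R :: "'k \<rightharpoonup> 'f rule" and \<Delta> :: "nat \<Rightarrow> kind"
    and e :: "('k, 'f) evid" and t :: "'f trm" and m :: nat
  assumes rules: "\<forall>\<rho>\<in>ran R. wf_rule ar \<rho>"
    and t: "wf_trm ar t"
    and typed: "typing ar (leibniz_env R) \<Delta> [] e (ty_of t)"
    and hhn: "e \<in> HHN"
  shows "\<exists>u. u 0 = t \<and>
    (\<forall>i\<le>m. action R e i (u i) = Some (u (Suc i)) \<and> (rewrite (ran R))\<^sup>*\<^sup>* (u i) (u (Suc i)))"
  using typed hhn
proof (induct m arbitrary: e t)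
  case (0 e t)
  from faithful_step[OF rules 0] obtain t' where
    "action R e 0 t = Some t'" "(rewrite (ran R))\<^sup>*\<^sup>* t t'" .
  then show ?case by (intro exI[of _ "case_nat t (\<lambda>_. t')"]) simp
next
  case (Suc m e t)
  from faithful_step[OF rules Suc.prems] obtain k Ts e' t' where
    next_e: "trace_next e = Some (k, Ts, e')"
    and first: "action R e 0 t = Some t'" "(rewrite (ran R))\<^sup>*\<^sup>* t t'"
    and e': "typing ar (leibniz_env R) \<Delta> [] e' (ty_of t')" "e' \<in> HHN" .
  from Suc.hyps[OF e'] obtain u where u: "u 0 = t'"
    "\<forall>i\<le>m. action R e' i (u i) = Some (u (Suc i)) \<and> (rewrite (ran R))\<^sup>*\<^sup>* (u i) (u (Suc i))"
    by blast
  \<comment> \<open>Prepending \<open>t\<close> shifts the sequence of \<open>e'\<close> by one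
    place, as \<open>action_Suc\<close> shifts the actions.\<close>
  have "action R e i (case_nat t u i) = Some (case_nat t u (Suc i)) \<and>
      (rewrite (ran R))\<^sup>*\<^sup>* (case_nat t u i) (case_nat t u (Suc i))" if "i \<le> Suc m" for i
    using that first u by (cases i) (auto simp: action_Suc[OF next_e])
  then show ?case by (intro exI[of _ "case_nat t u"]) simp
qed

end
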